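(* Consider the unidirectional horizontal model described in the context. (i) If $\mathrm{dist}_{i\leftarrow j}<\mathrm{dist}_{i\leftarrow j'}$ (where supply types $j,j'$ can both reach demand type $i$), the optimal policy matches $(i,j)$ before $(i,j')$. If $\mathrm{dist}_{i\leftarrow j}<\mathrm{dist}_{i'\leftarrow j}$ (where supply type $j$ can reach both demand types $i,i'$), the optimal policy matches $(i,j)$ before $(i',j)$. (ii) Suppose that $R^t$ decreases in $t$. If there are no other demand or supply types located between $i\in\mathcal D$ and $j\in\mathcal S$ on $C$ (where $j$ can reach $i$), then $i$ and $j$ should be matched with each other greedily, i.e. the optimal matching quantity is $q_{ij}^{t*}=\min\{x_i,y_j\}$ in every period $t$ and every state $(\mathbf x,\mathbf y)$.
   Context: Model. $T,m,n\ge1$ are integers, $\alpha,\beta\in[0,1]$ are the carry-over fractions of unmatched demand and supply, demand types $\mathcal D=\{1,\dots,m\}$, supply types $\mathcal S=\{1,\dots,n\}$, real unit matching rewards $r_{ij}^t$ ($1\le t\le T$), with $r_{ij}^{T+1}=0$ by convention. In each period $t$ random vectors $\mathbf D^t\in\mathbb R_+^m,\mathbf S^t\in\mathbb R_+^n$ of new demand and supply arrive; their distributions do not depend on matching decisions. The state $(\mathbf x,\mathbf y)\in\mathbb R_+^m\times\mathbb R_+^n$ in period $t$ lists available quantities after the arrivals of period $t$. A feasible decision is $\mathbf Q=(q_{ij})\in\mathbb R_+^{m\times n}$ with $u_i=x_i-\sum_jq_{ij}\ge0$, $v_j=y_j-\sum_iq_{ij}\ge0$. Put $V_{T+1}\equiv0$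 and for $t=T,\dots,1$ $$V_t(\mathbf x,\mathbf y)=\max_{\mathbf Q\text{ feasible}}\Big\{\sum_{i,j}r_{ij}^tq_{ij}+E\,V_{t+1}(\alpha\mathbf u+\mathbf D^{t+1},\beta\mathbf v+\mathbf S^{t+1})\Big\}.$$ A policy (a feasible decision for every $t$ and state) is optimal if it attains this maximum for every $t$ and every state. Rewards. All types are located on a line segment $C$ directed from endpoint $o$ to endpoint $d$; each type represents a distinct set of characteristics, and each point of $C$ represents the characteristics of the corresponding type (a demand type and a supply type may share a location). Supply type $j$ can reach demand type $i$ if the location of $i$ can be reached from the location of $j$ by traveling along the direction $o\to d$ (i.e. $i$ is located between $j$ and $d$), and then $\mathrm{dist}_{i\leftarrow j}$ is the distance traveled from $j$ to $i$ along $o\to d$. If $j$ can reach $i$ then $r_{ij}^t=R^t-\mathrm{dist}_{i\leftarrow j}$; otherwise $r_{ij}^t=0$. Priority. For $i\neq i'$, $(i,j)\succ_{\mathcal M}(i',j)$ means that for all $t=1,\dots,T$: $r_{ij}^t\ge r_{i'j}^t$ and $r_{ij}^t-r_{i'j}^t\ge\alpha(r_{ij''}^{t+1}-r_{i'j''}^{t+1})$ for all $j''\in\mathcal S$. For $j\neq j'$, $(i,j)\succ_{\mathcal M}(i,j')$ means that for all $t=1,\dots,T$: $r_{ij}^t\ge r_{ij'}^t$ and $r_{ij}^t-r_{ij'}^t\ge\beta(r_{i''j}^{t+1}-r_{i''j'}^{t+1})$ for all $i''\in\mathcal D$. The relation $\succ_{\mathcal M}$ is denoted $\succ_{\mathcal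 M_s}$ if for any $(i,j)\succ_{\mathcal M}(i',j)$ and $(i,j)\succ_{\mathcal M}(i,j')$ one has $r_{ij}^t+r_{i'j'}^t\ge r_{ij'}^t+r_{i'j}^t$ for all $t=1,\dots,T$. For a pair $(i,j)$ and a decision $(q_{ij}^t)$ in state $(\mathbf x,\mathbf y)$ put $a_i^t=x_i-\sum_{j''}q_{ij''}^t$, the sum over all $j''\in\mathcal S$ except those $j''\ne j$ with $(i,j)\succ_{\mathcal M_s}(i,j'')$, and $b_j^t=y_j-\sum_{i''}q_{i''j}^t$, the sum over all $i''\in\mathcal D$ except those $i''\ne i$ with $(i,j)\succ_{\mathcal M_s}(i'',j)$. A policy matches $(i,j)$ before $(i,j')$ if in every period and state either $q_{ij'}^t=0$ or $b_j^t=0$; it matches $(i,j)$ before $(i',j)$ if in every period and state either $q_{i'j}^t=0$ or $a_i^t=0$.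
   Formalization: Part (ii) is claimed only for periods with r_ij^t ≥ 0 (it fails for R^t < dist, e.g. T=m=n=1, R=0, dist=1); arrivals D^t, S^t are assumed to have finite means; "the optimal policy" is read as one optimal policy having all the stated properties. *)

theory Defs
  imports "HOL-Probability.Probability"
begin

section \<open>The two-sided dynamic matching model\<close>

text \<open>
  Demand types are the elements of a finite type \<open>'d\<close>, supply types those of a finite type \<open>'s\<close>.
  A decision is a matrix \<open>Q\<close> where \<open>Q $ i $ j\<close> is the quantity of demand \<open>i\<close> matched with supply \<open>j\<close>.
\<close>

definition is_state :: "real^'d::finite \<Rightarrow> real^'s::finite \<Rightarrow> bool" where
  "is_state x y \<longleftrightarrow> (\<forall>i. 0 \<le> x $ i) \<and> (\<forall>j. 0 \<le> y $ j)"

definition unmatched_demand :: "real^'d::finite \<Rightarrow> real^'s::finite^'d \<Rightarrow> real^'d" where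
  "unmatched_demand x Q = (\<chi> i. x $ i - (\<Sum>j\<in>UNIV. Q $ i $ j))"

definition unmatched_supply :: "real^'s::finite \<Rightarrow> real^'s^'d::finite \<Rightarrow> real^'s" where
  "unmatched_supply y Q = (\<chi> j. y $ j - (\<Sum>i\<in>UNIV. Q $ i $ j))"

definition feasible :: "real^'d::finite \<Rightarrow> real^'s::finite \<Rightarrow> real^'s^'d \<Rightarrow> bool" where
  "feasible x y Q \<longleftrightarrow>
     (\<forall>i j. 0 \<le> Q $ i $ j) \<and>
     (\<forall>i. 0 \<le> unmatched_demand x Q $ i) \<and>
     (\<forall>j. 0 \<le> unmatched_supply y Q $ j)"

text \<open>
  The maximand of the Bellman equation: \<open>\<rho>\<close> are the rewards of the current period, and
  \<open>W\<close>, \<open>D'\<close>, \<open>S'\<close> the value function and the arrivals of the next period.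
\<close>

definition decision_value ::
  "'w measure \<Rightarrow> real \<Rightarrow> real \<Rightarrow> ('d::finite \<Rightarrow> 's::finite \<Rightarrow> real) \<Rightarrow>
   (real^'d \<Rightarrow> real^'s \<Rightarrow> real) \<Rightarrow> ('w \<Rightarrow> real^'d) \<Rightarrow> ('w \<Rightarrow> real^'s) \<Rightarrow>
   real^'d \<Rightarrow> real^'s \<Rightarrow> real^'s^'d \<Rightarrow> real" where
  "decision_value M \<alpha> \<beta> \<rho> W D' S' x y Q =
     (\<Sum>i\<in>UNIV. \<Sum>j\<in>UNIV. \<rho> i j * Q $ i $ j) +
     (\<integral>\<omega>. W (\<alpha> *\<^sub>R unmatched_demand x Q + D' \<omega>) (\<beta> *\<^sub>R unmatched_supply y Q + S' \<omega>) \<partial>M)"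

text \<open>
  The value function by backward recursion. The maximum is written as a supremum; that it is
  attained is part of what \<open>optimal_policy\<close> below requires.
\<close>

function value_fun ::
  "'w measure \<Rightarrow> nat \<Rightarrow> real \<Rightarrow> real \<Rightarrow> (nat \<Rightarrow> 'd::finite \<Rightarrow> 's::finite \<Rightarrow> real) \<Rightarrow>
   (nat \<Rightarrow> 'w \<Rightarrow> real^'d) \<Rightarrow> (nat \<Rightarrow> 'w \<Rightarrow> real^'s) \<Rightarrow>
   nat \<Rightarrow> real^'d \<Rightarrow> real^'s \<Rightarrow> real" where
  "value_fun M T \<alpha> \<beta> r D S t =
     (if T < t then (\<lambda>x y. 0)
      else (\<lambda>x y. SUP Q \<in> {Q. feasible x y Q}.
              decision_value M \<alpha> \<beta> (r t) (value_fun M T \<alpha> \<beta> r D S (t + 1))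
                (D (t + 1)) (S (t + 1)) x y Q))"
  by pat_completeness auto
termination
  by (relation "Wellfounded.measure (\<lambda>(M, T, \<alpha>, \<beta>, r, D, S, t). Suc T - t)") auto

declare value_fun.simps [simp del]

text \<open>A policy maps a period and a state to a decision.\<close>

definition optimal_policy ::
  "'w measure \<Rightarrow> nat \<Rightarrow> real \<Rightarrow> real \<Rightarrow> (nat \<Rightarrow> 'd::finite \<Rightarrow> 's::finite \<Rightarrow> real) \<Rightarrow>
   (nat \<Rightarrow> 'w \<Rightarrow> real^'d) \<Rightarrow> (nat \<Rightarrow> 'w \<Rightarrow> real^'s) \<Rightarrow>
   (nat \<Rightarrow> real^'d \<Rightarrow> real^'s \<Rightarrow> real^'s^'d) \<Rightarrow> bool" where
  "optimal_policy M T \<alpha> \<beta> r D S P \<longleftrightarrow>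
     (\<forall>t\<in>{1..T}. \<forall>x y. is_state x y \<longrightarrow>
        feasible x y (P t x y) \<and>
        decision_value M \<alpha> \<beta> (r t) (value_fun M T \<alpha> \<beta> r D S (t + 1))
          (D (t + 1)) (S (t + 1)) x y (P t x y) = value_fun M T \<alpha> \<beta> r D S t x y)"


section \<open>Priority between pairs of types\<close>

text \<open>
  \<open>priority T \<alpha> \<beta> r (i, j) (i', j')\<close> is \<open>(i, j) \<succ> (i', j')\<close>; it relates only pairs that share
  exactly one component.
\<close>

definition priority ::
  "nat \<Rightarrow> real \<Rightarrow> real \<Rightarrow> (nat \<Rightarrow> 'd \<Rightarrow> 's \<Rightarrow> real) \<Rightarrow> 'd \<times> 's \<Rightarrow> 'd \<times> 's \<Rightarrow> bool" where
  "priority T \<alpha> \<beta> r = (\<lambda>(i, j) (i', j').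
     (i \<noteq> i' \<and> j = j' \<and>
       (\<forall>t\<in>{1..T}. r t i j \<ge> r t i' j \<and>
          (\<forall>j''. r t i j - r t i' j \<ge> \<alpha> * (r (t + 1) i j'' - r (t + 1) i' j'')))) \<or>
     (i = i' \<and> j \<noteq> j' \<and>
       (\<forall>t\<in>{1..T}. r t i j \<ge> r t i j' \<and>
          (\<forall>i''. r t i j - r t i j' \<ge> \<beta> * (r (t + 1) i'' j - r (t + 1) i'' j')))))"

definition priority_supermodular ::
  "nat \<Rightarrow> real \<Rightarrow> real \<Rightarrow> (nat \<Rightarrow> 'd \<Rightarrow> 's \<Rightarrow> real) \<Rightarrow> bool" where
  "priority_supermodular T \<alpha> \<beta> r \<longleftrightarrow>
     (\<forall>i i' j j'. priority T \<alpha> \<beta> r (i, j) (i', j) \<and> priority T \<alpha> \<beta> r (i, j) (i, j') \<longrightarrow>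
        (\<forall>t\<in>{1..T}. r t i j + r t i' j' \<ge> r t i j' + r t i' j))"

text \<open>
  The relation \<open>\<succ>\<close> is called \<open>\<succ>\<^sub>s\<close> when it is supermodular as a whole. By convention
  \<open>priority_s\<close> is the empty relation when it is not.
\<close>

definition priority_s ::
  "nat \<Rightarrow> real \<Rightarrow> real \<Rightarrow> (nat \<Rightarrow> 'd \<Rightarrow> 's \<Rightarrow> real) \<Rightarrow> 'd \<times> 's \<Rightarrow> 'd \<times> 's \<Rightarrow> bool" where
  "priority_s T \<alpha> \<beta> r p q \<longleftrightarrow> priority_supermodular T \<alpha> \<beta> r \<and> priority T \<alpha> \<beta> r p q"

text \<open>
  The quantities \<open>a\<^sub>i\<close> and \<open>b\<^sub>j\<close> for the pair \<open>(i, j)\<close>: what remains of demand \<open>i\<close> (of supply \<open>j\<close>)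
  once all matches except those of lower priority than \<open>(i, j)\<close> have been served.
\<close>

definition available_demand ::
  "nat \<Rightarrow> real \<Rightarrow> real \<Rightarrow> (nat \<Rightarrow> 'd::finite \<Rightarrow> 's::finite \<Rightarrow> real) \<Rightarrow>
   'd \<Rightarrow> 's \<Rightarrow> real^'d \<Rightarrow> real^'s^'d \<Rightarrow> real" where
  "available_demand T \<alpha> \<beta> r i j x Q =
     x $ i - (\<Sum>j''\<in>UNIV - {j''. j'' \<noteq> j \<and> priority_s T \<alpha> \<beta> r (i, j) (i, j'')}. Q $ i $ j'')"

definition available_supply ::
  "nat \<Rightarrow> real \<Rightarrow> real \<Rightarrow> (nat \<Rightarrow> 'd::finite \<Rightarrow> 's::finite \<Rightarrow> real) \<Rightarrow>
   'd \<Rightarrow> 's \<Rightarrow> real^'s \<Rightarrow> real^'s^'d \<Rightarrow> real" where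
  "available_supply T \<alpha> \<beta> r i j y Q =
     y $ j - (\<Sum>i''\<in>UNIV - {i''. i'' \<noteq> i \<and> priority_s T \<alpha> \<beta> r (i, j) (i'', j)}. Q $ i'' $ j)"

text \<open>The policy \<open>P\<close> matches \<open>(i, j)\<close> before \<open>(i, j')\<close>.\<close>

definition matches_before_supply ::
  "nat \<Rightarrow> real \<Rightarrow> real \<Rightarrow> (nat \<Rightarrow> 'd::finite \<Rightarrow> 's::finite \<Rightarrow> real) \<Rightarrow>
   (nat \<Rightarrow> real^'d \<Rightarrow> real^'s \<Rightarrow> real^'s^'d) \<Rightarrow> 'd \<Rightarrow> 's \<Rightarrow> 's \<Rightarrow> bool" where
  "matches_before_supply T \<alpha> \<beta> r P i j j' \<longleftrightarrow>
     (\<forall>t\<in>{1..T}. \<forall>x y. is_state x y \<longrightarrow>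
        P t x y $ i $ j' = 0 \<or> available_supply T \<alpha> \<beta> r i j y (P t x y) = 0)"

text \<open>The policy \<open>P\<close> matches \<open>(i, j)\<close> before \<open>(i', j)\<close>.\<close>

definition matches_before_demand ::
  "nat \<Rightarrow> real \<Rightarrow> real \<Rightarrow> (nat \<Rightarrow> 'd::finite \<Rightarrow> 's::finite \<Rightarrow> real) \<Rightarrow>
   (nat \<Rightarrow> real^'d \<Rightarrow> real^'s \<Rightarrow> real^'s^'d) \<Rightarrow> 'd \<Rightarrow> 'd \<Rightarrow> 's \<Rightarrow> bool" where
  "matches_before_demand T \<alpha> \<beta> r P i i' j \<longleftrightarrow>
     (\<forall>t\<in>{1..T}. \<forall>x y. is_state x y \<longrightarrow>
        P t x y $ i' $ j = 0 \<or> available_demand T \<alpha> \<beta> r i j x (P t x y) = 0)"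


section \<open>Unidirectional horizontal types\<close>

text \<open>
  Travel is along a segment towards its endpoint \<open>e\<close>; \<open>p\<close> and \<open>q\<close> are points of the segment, so
  the distance travelled from \<open>q\<close> to \<open>p\<close> is \<open>dist q p\<close>.
\<close>

definition can_reach :: "'a::euclidean_space \<Rightarrow> 'a \<Rightarrow> 'a \<Rightarrow> bool" where
  "can_reach e q p \<longleftrightarrow> p \<in> closed_segment q e"

definition unidirectional_reward ::
  "nat \<Rightarrow> (nat \<Rightarrow> real) \<Rightarrow> 'a::euclidean_space \<Rightarrow> ('d \<Rightarrow> 'a) \<Rightarrow> ('s \<Rightarrow> 'a) \<Rightarrow>
   nat \<Rightarrow> 'd \<Rightarrow> 's \<Rightarrow> real" where
  "unidirectional_reward T R e locD locS t i j =
     (if t \<in> {1..T} \<and> can_reach e (locS j) (locD i)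
      then R t - dist (locS j) (locD i) else 0)"

text \<open>
  No type other than \<open>i\<close> and \<open>j\<close> lies between the locations of \<open>j\<close> and \<open>i\<close>. The end points count:
  another demand type at the location of \<open>j\<close>, or another supply type at that of \<open>i\<close>, would be
  a strictly better partner.
\<close>

definition no_types_between ::
  "('d \<Rightarrow> 'a::euclidean_space) \<Rightarrow> ('s \<Rightarrow> 'a) \<Rightarrow> 'd \<Rightarrow> 's \<Rightarrow> bool" where
  "no_types_between locD locS i j \<longleftrightarrow>
     (\<forall>i'. i' \<noteq> i \<longrightarrow> locD i' \<notin> closed_segment (locS j) (locD i)) \<and>
     (\<forall>j'. j' \<noteq> j \<longrightarrow> locS j' \<notin> closed_segment (locS j) (locD i))"

end

theory Submission
  imports Defs
begin

text \<open>
  Let \<open>d i\<close> and \<open>s j\<close> be the distances of demand type \<open>i\<close> and supply type \<open>j\<close> from the start of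
  the segment. Then \<open>j\<close> reaches \<open>i\<close> iff \<open>s j \<le> d i\<close>, and the reward is \<open>R t - d i + s j\<close>. On
  reachable pairs it is a term of the demand plus a term of the supply, so re-pairing the same
  quantities is free in the current period; what distinguishes two decisions is which types they
  leave for the future.

  There are ties: with full carry-over it can be equally good to use a near or a far supply,
  and a maximiser of the Bellman equation need not have the asserted priorities. The policy
  exhibited here breaks ties. Among the maximisers it takes one with the largest total
  of a secondary weight, which is \<open>exp (s j - d i)\<close> on reachable pairs and negative on the others
  (\<open>nested_weight\<close>). This weight favours short distances, and of two pairings of the same
  types it favours the nested one over the crossing one. Every claim is then an exchange
  argument: if it failed, moving a small quantity within at most four cells would not lower the
  value and would raise the weight. This gives that unreachable pairs are not matched, that a near
  partner is used up before a far one is touched (\<open>near_supply_used_up\<close>), and that matches do not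
  cross (\<open>matches_do_not_cross\<close>). The last two together are part (i).

  The exchanges need two facts about the future value. First, a unit of supply at \<open>j\<close> is worth
  at most \<open>s j - s j'\<close> more than one at \<open>j'\<close>, for \<open>j'\<close> before \<open>j\<close> on the line
  (\<open>supply_shift_bound\<close>): whatever \<open>j\<close> reaches, \<open>j'\<close> reaches too. Second, for part (ii), if nothing
  lies between \<open>j\<close> and \<open>i\<close> and their reward with each other is not negative, then a unit of both
  is never worth more than this reward (\<open>pair_bound\<close>): if later \<open>i\<close> is matched with \<open>j'\<close> and \<open>j\<close>
  with \<open>i'\<close>, then \<open>j'\<close> and \<open>i'\<close> could have been matched instead, and the difference is exactly
  the reward of \<open>(i, j)\<close> in that period. As \<open>R\<close> decreases, waiting does not increase it, so matching \<open>i\<close> with \<open>j\<close> at once loses nothing.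

  Both facts pass from one period to the previous one. Through the expectation they pass because
  the carry-over fractions are at most 1. Through the maximisation they pass by a continuity
  argument (\<open>le_along_path\<close>): along a line of states it suffices to compare each
  state with some slightly earlier one, and there a single small change of an optimal decision is
  enough. The continuity used here, the attainment of the maximum and the integrability of the next
  value all come from a Lipschitz bound (\<open>monotone_lipschitz\<close>), which is inherited in the same way.
  Statements about demand follow from those about supply by exchanging the two sides and reversing
  the line.
\<close>

section \<open>Moving quantities between cells\<close>

definition cell :: "'d::finite \<Rightarrow> 's::finite \<Rightarrow> real^'s^'d" where
  "cell i j = axis i (axis j 1)"

definition linear_reward :: "('d::finite \<Rightarrow> 's::finite \<Rightarrow> real) \<Rightarrow> real^'s^'d \<Rightarrow> real" where
  "linear_reward \<rho> Q = (\<Sum>i\<in>UNIV. \<Sum>j\<in>UNIV. \<rho> i j * Q $ i $ j)"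

lemma cell_nth: "cell i j $ k $ l = (if k = i \<and> l = j then 1 else 0)"
  by (simp add: cell_def axis_def)

lemma sum_cell:
  "(\<Sum>l\<in>UNIV. cell i j $ k $ l) = (if k = i then 1 else 0)"
  "(\<Sum>k\<in>UNIV. cell i j $ k $ l) = (if l = j then 1 else 0)"
  by (simp_all add: cell_nth sum.If_cases)

lemma unmatched_cell [simp]:
  "unmatched_demand x (Q + h *\<^sub>R cell i j) = unmatched_demand x Q - h *\<^sub>R axis i 1"
  "unmatched_demand x (Q - h *\<^sub>R cell i j) = unmatched_demand x Q + h *\<^sub>R axis i 1"
  "unmatched_supply y (Q + h *\<^sub>R cell i j) = unmatched_supply y Q - h *\<^sub>R axis j 1"
  "unmatched_supply y (Q - h *\<^sub>R cell i j) = unmatched_supply y Q + h *\<^sub>R axis j 1"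
  by (simp_all add: vec_eq_iff unmatched_demand_def unmatched_supply_def sum.distrib sum_subtractf
      sum_distrib_left[symmetric] sum_cell axis_def)

lemma unmatched_state [simp]:
  "unmatched_demand (x + a) Q = unmatched_demand x Q + a"
  "unmatched_demand (x - a) Q = unmatched_demand x Q - a"
  "unmatched_supply (y + b) Q = unmatched_supply y Q + b"
  "unmatched_supply (y - b) Q = unmatched_supply y Q - b"
  by (simp_all add: vec_eq_iff unmatched_demand_def unmatched_supply_def)

lemma linear_reward_cell [simp]:
  "linear_reward \<rho> (Q + h *\<^sub>R cell i j) = linear_reward \<rho> Q + h * \<rho> i j"
  "linear_reward \<rho> (Q - h *\<^sub>R cell i j) = linear_reward \<rho> Q - h * \<rho> i j"
proof -
  have "(\<Sum>l\<in>UNIV. \<rho> k l * (h * cell i j $ k $ l)) = (if k = i then h * \<rho> i j else 0)" for k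
  proof -
    have "(\<Sum>l\<in>UNIV. \<rho> k l * (h * cell i j $ k $ l))
        = (\<Sum>l\<in>UNIV. if l = j then (if k = i then h * \<rho> i j else 0) else 0)"
      by (rule sum.cong) (auto simp: cell_nth)
    then show ?thesis by simp
  qed
  then have "(\<Sum>k\<in>UNIV. \<Sum>l\<in>UNIV. \<rho> k l * (h * cell i j $ k $ l)) = h * \<rho> i j"
    by simp
  then show "linear_reward \<rho> (Q + h *\<^sub>R cell i j) = linear_reward \<rho> Q + h * \<rho> i j"
    "linear_reward \<rho> (Q - h *\<^sub>R cell i j) = linear_reward \<rho> Q - h * \<rho> i j"
    by (simp_all add: linear_reward_def algebra_simps sum.distrib sum_subtractf)
qed

lemma feasible_iff:
  "feasible x y Q \<longleftrightarrow>
    (\<forall>i j. 0 \<le> Q $ i $ j) \<and> is_state (unmatched_demand x Q) (unmatched_supply y Q)"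
  by (auto simp: feasible_def is_state_def)

lemma feasible_zero: "is_state x y \<Longrightarrow> feasible x y 0"
  by (auto simp: feasible_def is_state_def unmatched_demand_def unmatched_supply_def)

lemma is_state_swap: "is_state y x \<longleftrightarrow> is_state x y"
  by (auto simp: is_state_def)

lemma is_state_add_supply: "is_state x y \<Longrightarrow> 0 \<le> h \<Longrightarrow> is_state x (y + h *\<^sub>R axis j 1)"
  and is_state_diff_supply: "is_state x y \<Longrightarrow> h \<le> y $ j \<Longrightarrow> is_state x (y - h *\<^sub>R axis j 1)"
  and is_state_add_demand: "is_state x y \<Longrightarrow> 0 \<le> h \<Longrightarrow> is_state (x + h *\<^sub>R axis i 1) y"
  and is_state_diff_demand: "is_state x y \<Longrightarrow> h \<le> x $ i \<Longrightarrow> is_state (x - h *\<^sub>R axis i 1) y"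
  by (auto simp: is_state_def axis_def)

lemma demand_balance: "x $ i = unmatched_demand x Q $ i + (\<Sum>j\<in>UNIV. Q $ i $ j)"
  by (simp add: unmatched_demand_def)

lemma supply_balance: "y $ j = unmatched_supply y Q $ j + (\<Sum>i\<in>UNIV. Q $ i $ j)"
  by (simp add: unmatched_supply_def)

lemma demand_used:
  assumes "feasible x y Q" "0 < x $ i"
  obtains "0 < unmatched_demand x Q $ i" | j where "0 < Q $ i $ j"
proof (cases "0 < unmatched_demand x Q $ i")
  case False
  then have "unmatched_demand x Q $ i = 0" using assms(1) by (auto simp: feasible_def less_le)
  then have "0 < (\<Sum>j\<in>UNIV. Q $ i $ j)" using demand_balance[of x i Q] assms(2) by simp
  then have "\<not> (\<forall>j. Q $ i $ j \<le> 0)" using sum_nonpos[of UNIV "\<lambda>j. Q $ i $ j"] by force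
  then show ?thesis using that by (auto simp: not_le)
qed (use that in auto)

lemma supply_used:
  assumes "feasible x y Q" "0 < y $ j"
  obtains "0 < unmatched_supply y Q $ j" | i where "0 < Q $ i $ j"
proof (cases "0 < unmatched_supply y Q $ j")
  case False
  then have "unmatched_supply y Q $ j = 0" using assms(1) by (auto simp: feasible_def less_le)
  then have "0 < (\<Sum>i\<in>UNIV. Q $ i $ j)" using supply_balance[of y j Q] assms(2) by simp
  then have "\<not> (\<forall>i. Q $ i $ j \<le> 0)" using sum_nonpos[of UNIV "\<lambda>i. Q $ i $ j"] by force
  then show ?thesis using that by (auto simp: not_le)
qed (use that in auto)

section \<open>Bellman step and exchange of the two sides\<close>

lemma unmatched_transpose:
  "unmatched_demand y (transpose Q) = unmatched_supply y Q"
  "unmatched_supply x (transpose Q) = unmatched_demand x Q"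
  by (simp_all add: unmatched_demand_def unmatched_supply_def transpose_def)

lemma feasible_transpose: "feasible y x (transpose Q) \<longleftrightarrow> feasible x y Q"
  unfolding feasible_iff unmatched_transpose is_state_swap[of "unmatched_supply y Q"]
  by (auto simp: transpose_def)

lemma linear_reward_transpose:
  "linear_reward (\<lambda>j i. \<rho> i j) (transpose Q) = linear_reward \<rho> Q"
  unfolding linear_reward_def by (subst sum.swap) (simp add: transpose_def)

text \<open>
  The argument \<open>G\<close> is the expected value of the quantities left unmatched, so that one period of
  the model is separated from the arrivals.
\<close>

definition total_value where
  "total_value \<rho> G x y Q =
    linear_reward \<rho> Q + G (unmatched_demand x Q) (unmatched_supply y Q)"

definition bellman ::
  "('d::finite \<Rightarrow> 's::finite \<Rightarrow> real) \<Rightarrow> (real^'d \<Rightarrow> real^'s \<Rightarrow> real) \<Rightarrow>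
   real^'d \<Rightarrow> real^'s \<Rightarrow> real" where
  "bellman \<rho> G x y = (SUP Q\<in>{Q. feasible x y Q}. total_value \<rho> G x y Q)"

lemma total_value_transpose:
  "total_value (\<lambda>j i. \<rho> i j) (\<lambda>v u. G u v) y x (transpose Q) = total_value \<rho> G x y Q"
  by (simp add: total_value_def linear_reward_transpose unmatched_transpose)

lemma all_transpose: "(\<forall>Q::'a^'n^'m. P (transpose Q)) \<longleftrightarrow> (\<forall>Q. P Q)"
  by (metis transpose_transpose)

lemma bellman_transpose: "bellman (\<lambda>j i. \<rho> i j) (\<lambda>v u. G u v) y x = bellman \<rho> G x y"
proof -
  have "{Q. feasible y x Q} = transpose ` {Q. feasible x y Q}"
    by (auto simp: feasible_transpose) (metis feasible_transpose image_eqI mem_Collect_eq transpose_transpose)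
  then show ?thesis
    unfolding bellman_def by (simp add: image_image total_value_transpose)
qed

section \<open>Monotone Lipschitz value functions\<close>

definition excess :: "real^'n::finite \<Rightarrow> real^'n \<Rightarrow> real" where
  "excess x' x = (\<Sum>i\<in>UNIV. max 0 (x' $ i - x $ i))"

text \<open>
  Bounding the increase by the positive part of the difference of the states makes one inequality
  express both monotonicity (for \<open>x' \<le> x\<close> and \<open>y' \<le> y\<close> the bound is \<open>W x y\<close>) and Lipschitz
  continuity in the sum norm.
\<close>

definition monotone_lipschitz :: "real \<Rightarrow> (real^'d::finite \<Rightarrow> real^'s::finite \<Rightarrow> real) \<Rightarrow> bool" where
  "monotone_lipschitz K W \<longleftrightarrow> 0 \<le> K \<and>
    (\<forall>x y x' y'. is_state x y \<longrightarrow> is_state x' y' \<longrightarrow>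
      W x' y' \<le> W x y + K * (excess x' x + excess y' y))"

lemma monotone_lipschitzD:
  "monotone_lipschitz K W \<Longrightarrow> is_state x y \<Longrightarrow> is_state x' y' \<Longrightarrow>
    W x' y' \<le> W x y + K * (excess x' x + excess y' y)"
  by (simp add: monotone_lipschitz_def)

lemma excess_nonneg: "0 \<le> excess x' x"
  by (simp add: excess_def sum_nonneg)

lemma excess_eq_0: "(\<And>i. x' $ i \<le> x $ i) \<Longrightarrow> excess x' x = 0"
  by (simp add: excess_def)

lemma excess_le_dist: "excess x' (x::real^'n::finite) \<le> CARD('n) * dist x' x"
proof -
  have "excess x' x \<le> (\<Sum>i\<in>(UNIV::'n set). dist x' x)"
    unfolding excess_def
  proof (rule sum_mono)
    fix i
    have "x' $ i - x $ i \<le> dist x' x"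
      using component_le_norm_cart[of "x' - x" i] by (simp add: dist_norm)
    then show "max 0 (x' $ i - x $ i) \<le> dist x' x" by simp
  qed
  then show ?thesis by simp
qed

lemma monotone_lipschitz_mono: "monotone_lipschitz K W \<Longrightarrow> K \<le> K' \<Longrightarrow> monotone_lipschitz K' W"
  unfolding monotone_lipschitz_def
  by (smt (verit) mult_right_mono excess_nonneg)

lemma monotone_lipschitz_swap:
  assumes "monotone_lipschitz K W" shows "monotone_lipschitz K (\<lambda>y x. W x y)"
  using assms unfolding monotone_lipschitz_def by (metis is_state_swap add.commute)

lemma state_monotone:
  assumes "monotone_lipschitz K W" "is_state x y" "is_state x' y'"
    "\<And>i. x $ i \<le> x' $ i" "\<And>j. y $ j \<le> y' $ j"
  shows "W x y \<le> W x' y'"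
  using monotone_lipschitzD[OF assms(1,3,2)] assms(4,5) by (simp add: excess_eq_0)

lemma continuous_on_states:
  assumes "monotone_lipschitz K (W :: real^'d::finite \<Rightarrow> real^'s::finite \<Rightarrow> real)"
  shows "continuous_on {p. is_state (fst p) (snd p)} (\<lambda>p. W (fst p) (snd p))"
proof (rule lipschitz_on_continuous_on)
  let ?L = "K * (CARD('d) + CARD('s))"
  have K: "0 \<le> K" using assms by (simp add: monotone_lipschitz_def)
  have bound: "W (fst p) (snd p) \<le> W (fst q) (snd q) + ?L * dist p q"
    if "is_state (fst p) (snd p)" "is_state (fst q) (snd q)" for p q
  proof -
    have "excess (fst p) (fst q) \<le> CARD('d) * dist p q"
      by (rule order_trans[OF excess_le_dist]) (simp add: dist_fst_le mult_left_mono)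
    moreover have "excess (snd p) (snd q) \<le> CARD('s) * dist p q"
      by (rule order_trans[OF excess_le_dist]) (simp add: dist_snd_le mult_left_mono)
    ultimately have "K * (excess (fst p) (fst q) + excess (snd p) (snd q)) \<le> ?L * dist p q"
      using K by (simp add: mult.assoc distrib_right mult_left_mono add_mono)
    then show ?thesis using monotone_lipschitzD[OF assms that(2,1)] by linarith
  qed
  show "?L-lipschitz_on {p. is_state (fst p) (snd p)} (\<lambda>p. W (fst p) (snd p))"
  proof (rule lipschitz_onI)
    fix p q :: "(real^'d) \<times> (real^'s)"
    assume "p \<in> {p. is_state (fst p) (snd p)}" "q \<in> {p. is_state (fst p) (snd p)}"
    then show "dist (W (fst p) (snd p)) (W (fst q) (snd q)) \<le> ?L * dist p q"
      using bound[of p q] bound[of q p] by (auto simp: dist_real_def dist_commute)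
  qed (use K in simp)
qed

lemma continuous_on_state_path:
  assumes "monotone_lipschitz K W" "continuous_on A X" "continuous_on A Y"
    and "\<And>\<delta>. \<delta> \<in> A \<Longrightarrow> is_state (X \<delta>) (Y \<delta>)"
  shows "continuous_on A (\<lambda>\<delta>. W (X \<delta>) (Y \<delta>))"
proof -
  have "continuous_on A (\<lambda>\<delta>. (X \<delta>, Y \<delta>))"
    using assms(2,3) by (rule continuous_on_Pair)
  moreover have "(\<lambda>\<delta>. (X \<delta>, Y \<delta>)) ` A \<subseteq> {p. is_state (fst p) (snd p)}"
    using assms(4) by auto
  ultimately show ?thesis
    using continuous_on_compose2[OF continuous_on_states[OF assms(1)]] by fastforce
qed

section \<open>Maximisers of the Bellman step\<close>

lemma continuous_on_unmatched [continuous_intros]: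
  "continuous_on A (unmatched_demand x)" "continuous_on A (unmatched_supply y)"
  unfolding unmatched_demand_def unmatched_supply_def by (intro continuous_intros)+

lemma continuous_on_linear_reward [continuous_intros]: "continuous_on A (linear_reward \<rho>)"
  unfolding linear_reward_def by (intro continuous_intros)

lemma compact_feasible: "compact {Q. feasible x y Q}"
proof -
  have "norm Q \<le> (\<Sum>i\<in>UNIV. x $ i)" if "feasible x y Q" for Q
  proof -
    have "norm (Q $ i) \<le> x $ i" for i
    proof -
      have "norm (Q $ i) \<le> (\<Sum>j\<in>UNIV. \<bar>Q $ i $ j\<bar>)" by (rule norm_le_l1_cart)
      also have "\<dots> = (\<Sum>j\<in>UNIV. Q $ i $ j)" using that by (simp add: feasible_def)
      also have "\<dots> \<le> x $ i"
        using that demand_balance[of x i Q] by (simp add: feasible_def)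
      finally show ?thesis .
    qed
    moreover have "norm Q \<le> (\<Sum>i\<in>UNIV. norm (Q $ i))"
      unfolding norm_vec_def by (rule L2_set_le_sum) simp
    ultimately show ?thesis by (meson order_trans sum_mono)
  qed
  then have "bounded {Q. feasible x y Q}" unfolding bounded_iff by blast
  moreover have "closed {Q. feasible x y Q}"
    unfolding feasible_def unmatched_demand_def unmatched_supply_def vec_lambda_beta
    by (intro closed_Collect_conj closed_Collect_all closed_Collect_le continuous_intros)
  ultimately show ?thesis by (simp add: compact_eq_bounded_closed)
qed

definition tie_optimal where
  "tie_optimal \<rho> G w x y Q \<longleftrightarrow> feasible x y Q \<and>
    (\<forall>Q'. feasible x y Q' \<longrightarrow> total_value \<rho> G x y Q' \<le> total_value \<rho> G x y Q \<and>
      (total_value \<rho> G x y Q \<le> total_value \<rho> G x y Q' \<longrightarrow> linear_reward w Q' \<le> linear_reward w Q))"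

lemma tie_optimal_bellman: "tie_optimal \<rho> G w x y Q \<Longrightarrow> bellman \<rho> G x y = total_value \<rho> G x y Q"
  unfolding bellman_def tie_optimal_def by (intro cSup_eq_maximum) auto

lemma tie_optimal_transpose:
  "tie_optimal (\<lambda>j i. \<rho> i j) (\<lambda>v u. G u v) (\<lambda>j i. w i j) y x (transpose Q) \<longleftrightarrow> tie_optimal \<rho> G w x y Q"
  unfolding tie_optimal_def
  by (subst all_transpose[symmetric])
    (simp add: feasible_transpose total_value_transpose linear_reward_transpose)

text \<open>
  The value is continuous on the compact set of feasible decisions, so its maximisers form a
  nonempty compact set, on which the linear secondary objective attains a maximum too.
\<close>

lemma ex_tie_optimal:
  assumes G: "monotone_lipschitz K G" and xy: "is_state x y"
  shows "\<exists>Q. tie_optimal \<rho> G w x y Q"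
proof -
  let ?F = "{Q. feasible x y Q}" and ?f = "total_value \<rho> G x y"
  have "continuous_on ?F (\<lambda>Q. G (unmatched_demand x Q) (unmatched_supply y Q))"
    by (rule continuous_on_state_path[OF G]) (auto simp: feasible_iff intro: continuous_intros)
  then have f: "continuous_on ?F ?f"
    unfolding total_value_def by (intro continuous_intros)
  have "?F \<noteq> {}" using feasible_zero[OF xy] by blast
  then obtain Q0 where Q0: "Q0 \<in> ?F" "\<And>Q. Q \<in> ?F \<Longrightarrow> ?f Q \<le> ?f Q0"
    using continuous_attains_sup[OF compact_feasible _ f] by blast
  let ?O = "?F \<inter> ?f -` {?f Q0..}"
  have "closed ?O"
    using continuous_closed_preimage[OF f compact_imp_closed[OF compact_feasible]] by blast
  then have "compact ?O"
    using compact_Int_closed[OF compact_feasible, of ?O x y] by (simp add: Int_assoc[symmetric])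
  moreover have "?O \<noteq> {}" using Q0 by auto
  ultimately obtain Q where Q: "Q \<in> ?O" "\<And>Q'. Q' \<in> ?O \<Longrightarrow> linear_reward w Q' \<le> linear_reward w Q"
    using continuous_attains_sup[of ?O "linear_reward w"] continuous_on_linear_reward by metis
  have "?f Q = ?f Q0" using Q(1) Q0(2)[of Q] by auto
  then show ?thesis using Q Q0 unfolding tie_optimal_def by (intro exI[of _ Q]) auto
qed

lemma total_value_le_bellman:
  assumes "monotone_lipschitz K G" "feasible x y Q" "is_state x y"
  shows "total_value \<rho> G x y Q \<le> bellman \<rho> G x y"
  using ex_tie_optimal[OF assms(1,3), of \<rho> \<rho>] assms(2)
  by (metis tie_optimal_bellman tie_optimal_def)


section \<open>Lipschitz bound for the Bellman step\<close>

lemma feasible_imp_state: "feasible x y Q \<Longrightarrow> is_state x y"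
  unfolding is_state_def feasible_def
  by (metis demand_balance supply_balance add_nonneg_nonneg sum_nonneg)

lemma bellman_le_move:
  assumes "tie_optimal \<rho> G w x y Q" "monotone_lipschitz K G" "feasible x' y' Q'"
    "total_value \<rho> G x y Q \<le> total_value \<rho> G x' y' Q' + e"
  shows "bellman \<rho> G x y \<le> bellman \<rho> G x' y' + e"
  using total_value_le_bellman[OF assms(2,3) feasible_imp_state[OF assms(3)], of \<rho>]
    tie_optimal_bellman[OF assms(1)] assms(4) by linarith

text \<open>
  Given an optimal decision for \<open>(x', y')\<close>, each row and each column is scaled down in
  proportion to what is missing in \<open>(x, y)\<close>. A unit of a type that is missing was either
  matched, losing a reward of at most \<open>K\<close>, or left over, losing at most \<open>K\<close> in the next period.
\<close>

lemma bellman_monotone_lipschitz: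
  fixes \<rho> :: "'d::finite \<Rightarrow> 's::finite \<Rightarrow> real"
  assumes G: "monotone_lipschitz K G" and \<rho>: "\<And>i j. \<rho> i j \<le> K"
  shows "monotone_lipschitz K (bellman \<rho> G)"
  unfolding monotone_lipschitz_def
proof (intro conjI allI impI)
  show K: "0 \<le> K" using G by (simp add: monotone_lipschitz_def)
  fix x x' :: "real^'d" and y y' :: "real^'s"
  assume xy: "is_state x y" and xy': "is_state x' y'"
  obtain Q where Q: "tie_optimal \<rho> G \<rho> x' y' Q" using ex_tie_optimal[OF G xy'] by blast
  then have feas: "feasible x' y' Q" by (simp add: tie_optimal_def)
  then have q: "0 \<le> Q $ i $ j" for i j by (simp add: feasible_def)
  define l where "l i = (if x' $ i \<le> x $ i then 1 else x $ i / x' $ i)" for i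
  define m where "m j = (if y' $ j \<le> y $ j then 1 else y $ j / y' $ j)" for j
  have l: "0 \<le> l i" "l i \<le> 1" "l i * x' $ i \<le> x $ i" "(1 - l i) * x' $ i = max 0 (x' $ i - x $ i)" for i
    using xy xy' by (auto simp: l_def is_state_def field_simps)
      (smt (verit) divide_le_eq_1 not_le zero_le_divide_iff)+
  have m: "0 \<le> m j" "m j \<le> 1" "m j * y' $ j \<le> y $ j" "(1 - m j) * y' $ j = max 0 (y' $ j - y $ j)" for j
    using xy xy' by (auto simp: m_def is_state_def field_simps)
      (smt (verit) divide_le_eq_1 not_le zero_le_divide_iff)+
  define Q' :: "real^'s^'d" where "Q' = (\<chi> i j. l i * m j * Q $ i $ j)"
  let ?u = "unmatched_demand x' Q" and ?u' = "unmatched_demand x Q'"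
  let ?v = "unmatched_supply y' Q" and ?v' = "unmatched_supply y Q'"
  have uv: "0 \<le> ?u $ i" "0 \<le> ?v $ j" for i j using feas by (simp_all add: feasible_def)
  have u': "l i * ?u $ i \<le> ?u' $ i" for i
  proof -
    have "(\<Sum>j\<in>UNIV. l i * m j * Q $ i $ j) \<le> (\<Sum>j\<in>UNIV. l i * Q $ i $ j)"
      using l(1)[of i] m(1,2) q
      by (intro sum_mono mult_right_mono mult_left_le) auto
    then show ?thesis using l(3)[of i]
      by (simp add: unmatched_demand_def Q'_def right_diff_distrib sum_distrib_left)
  qed
  have v': "m j * ?v $ j \<le> ?v' $ j" for j
  proof -
    have "(\<Sum>i\<in>UNIV. l i * m j * Q $ i $ j) \<le> (\<Sum>i\<in>UNIV. m j * Q $ i $ j)"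
      using m(1)[of j] l(1,2) q
      by (intro sum_mono mult_right_mono mult_left_le_one_le) auto
    then show ?thesis using m(3)[of j]
      by (simp add: unmatched_supply_def Q'_def right_diff_distrib sum_distrib_left)
  qed
  have feas': "feasible x y Q'"
    unfolding feasible_def
    using order_trans[OF mult_nonneg_nonneg[OF l(1) uv(1)] u']
      order_trans[OF mult_nonneg_nonneg[OF m(1) uv(2)] v']
    by (simp add: l(1) m(1) q Q'_def)
  \<comment> \<open>The amounts lost from matches by the row scaling and by the column scaling; they are charged
    once, here, and are subtracted from what can still be lost in the next period.\<close>
  let ?A = "\<Sum>i\<in>UNIV. \<Sum>j\<in>UNIV. (1 - l i) * Q $ i $ j"
  let ?B = "\<Sum>i\<in>UNIV. \<Sum>j\<in>UNIV. (1 - m j) * Q $ i $ j"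
  have "excess ?u ?u' \<le> (\<Sum>i\<in>UNIV. (1 - l i) * ?u $ i)"
    unfolding excess_def
  proof (intro sum_mono max.boundedI)
    fix i show "0 \<le> (1 - l i) * ?u $ i" using l(2) uv by simp
    show "?u $ i - ?u' $ i \<le> (1 - l i) * ?u $ i" using u'[of i] by (simp add: left_diff_distrib)
  qed
  also have "\<dots> = excess x' x - ?A"
    by (simp add: excess_def l(4)[symmetric] unmatched_demand_def right_diff_distrib
        sum_subtractf sum_distrib_left)
  finally have eu: "excess ?u ?u' \<le> excess x' x - ?A" .
  have "excess ?v ?v' \<le> (\<Sum>j\<in>UNIV. (1 - m j) * ?v $ j)"
    unfolding excess_def
  proof (intro sum_mono max.boundedI)
    fix j show "0 \<le> (1 - m j) * ?v $ j" using m(2) uv by simp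
    show "?v $ j - ?v' $ j \<le> (1 - m j) * ?v $ j" using v'[of j] by (simp add: left_diff_distrib)
  qed
  also have "\<dots> = excess y' y - (\<Sum>j\<in>UNIV. \<Sum>i\<in>UNIV. (1 - m j) * Q $ i $ j)"
    by (simp add: excess_def m(4)[symmetric] unmatched_supply_def right_diff_distrib
        sum_subtractf sum_distrib_left)
  also have "(\<Sum>j\<in>UNIV. \<Sum>i\<in>UNIV. (1 - m j) * Q $ i $ j) = ?B" by (rule sum.swap)
  finally have ev: "excess ?v ?v' \<le> excess y' y - ?B" .
  have "linear_reward \<rho> Q - linear_reward \<rho> Q'
      = (\<Sum>i\<in>UNIV. \<Sum>j\<in>UNIV. \<rho> i j * ((1 - l i * m j) * Q $ i $ j))"
    by (simp add: linear_reward_def Q'_def sum_subtractf[symmetric] algebra_simps)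
  also have "\<dots> \<le> (\<Sum>i\<in>UNIV. \<Sum>j\<in>UNIV. K * ((1 - l i) * Q $ i $ j + (1 - m j) * Q $ i $ j))"
  proof (intro sum_mono mult_mono \<rho> K)
    fix i j
    have "0 \<le> (1 - l i) * (1 - m j)" using l(2) m(2) by simp
    then have "1 - l i * m j \<le> (1 - l i) + (1 - m j)" by (simp add: algebra_simps)
    then show "(1 - l i * m j) * Q $ i $ j \<le> (1 - l i) * Q $ i $ j + (1 - m j) * Q $ i $ j"
      using q[of i j] by (metis distrib_right mult_right_mono)
    show "0 \<le> (1 - l i * m j) * Q $ i $ j" using l(1,2) m(1,2) q by (simp add: mult_le_one)
  qed
  also have "\<dots> = K * (?A + ?B)"
    by (simp add: sum_distrib_left[symmetric] sum.distrib)
  finally have "linear_reward \<rho> Q - linear_reward \<rho> Q' \<le> K * (?A + ?B)" .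
  moreover have "G ?u ?v \<le> G ?u' ?v' + K * (excess ?u ?u' + excess ?v ?v')"
    using monotone_lipschitzD[OF G] feas feas' by (auto simp: feasible_iff)
  moreover have "K * (excess ?u ?u' + excess ?v ?v') \<le> K * (excess x' x - ?A + (excess y' y - ?B))"
    using eu ev K by (intro mult_left_mono) auto
  ultimately have "total_value \<rho> G x' y' Q \<le> total_value \<rho> G x y Q' + K * (excess x' x + excess y' y)"
    unfolding total_value_def by (simp add: algebra_simps)
  then show "bellman \<rho> G x' y' \<le> bellman \<rho> G x y + K * (excess x' x + excess y' y)"
    by (rule bellman_le_move[OF Q G feas'])
qed

lemma bellman_ex_monotone_lipschitz:
  fixes \<rho> :: "'d::finite \<Rightarrow> 's::finite \<Rightarrow> real"
  assumes G: "monotone_lipschitz K G"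
  obtains K' where "monotone_lipschitz K' (bellman \<rho> G)"
proof -
  let ?K = "max K (Max (range (\<lambda>(i, j). \<rho> i j)))"
  have "\<rho> i j \<le> Max (range (\<lambda>(i, j). \<rho> i j))" for i j
    by (rule Max_ge) (auto intro: rev_image_eqI[of "(i, j)"])
  then have "monotone_lipschitz ?K (bellman \<rho> G)"
    by (intro bellman_monotone_lipschitz monotone_lipschitz_mono[OF G]) (auto simp: le_max_iff_disj)
  then show ?thesis by (rule that)
qed

section \<open>Rewards on a line and exchange arguments\<close>

definition line_reward :: "real \<Rightarrow> ('d \<Rightarrow> real) \<Rightarrow> ('s \<Rightarrow> real) \<Rightarrow> 'd \<Rightarrow> 's \<Rightarrow> real" where
  "line_reward c d s i j = (if s j \<le> d i then c - (d i - s j) else 0)"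

text \<open>
  On reachable pairs the weight is a product of an increasing function of \<open>s j\<close> and a decreasing
  one of \<open>d i\<close>. Hence it decreases with the distance, and \<open>(i, j), (i', j')\<close> weighs strictly more
  than \<open>(i, j'), (i', j)\<close> when \<open>s j' < s j \<le> d i < d i'\<close>, although these have equal total distance.
  The negative value makes matching an unreachable pair a loss.
\<close>

definition nested_weight :: "('d \<Rightarrow> real) \<Rightarrow> ('s \<Rightarrow> real) \<Rightarrow> 'd \<Rightarrow> 's \<Rightarrow> real" where
  "nested_weight d s i j = (if s j \<le> d i then exp (s j - d i) else - 1)"

abbreviation line_optimal where
  "line_optimal c d s G \<equiv> tie_optimal (line_reward c d s) G (nested_weight d s)"

abbreviation reversed :: "('t \<Rightarrow> real) \<Rightarrow> 't \<Rightarrow> real" where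
  "reversed p \<equiv> \<lambda>k. - p k"

text \<open>
  Exchanging demand and supply reverses the direction of travel; negating all coordinates
  restores it.
\<close>

lemma line_reward_reversed: "line_reward c (reversed s) (reversed d) = (\<lambda>j i. line_reward c d s i j)"
  by (auto simp: line_reward_def fun_eq_iff)

lemma line_optimal_reversed:
  "line_optimal c (reversed s) (reversed d) (\<lambda>v u. G u v) y x (transpose Q) \<longleftrightarrow> line_optimal c d s G x y Q"
proof -
  have "nested_weight (reversed s) (reversed d) = (\<lambda>j i. nested_weight d s i j)"
    by (auto simp: nested_weight_def fun_eq_iff)
  then show ?thesis
    using tie_optimal_transpose[of "line_reward c d s" G "nested_weight d s"]
    by (simp add: line_reward_reversed)
qed

definition supply_shift_bound :: "('s \<Rightarrow> real) \<Rightarrow> (real^'d::finite \<Rightarrow> real^'s::finite \<Rightarrow> real) \<Rightarrow> bool" where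
  "supply_shift_bound s W \<longleftrightarrow> (\<forall>x y j j' h. is_state x y \<longrightarrow> 0 \<le> h \<longrightarrow> s j' \<le> s j \<longrightarrow>
     W x (y + h *\<^sub>R axis j 1) \<le> W x (y + h *\<^sub>R axis j' 1) + h * (s j - s j'))"

lemma supply_shift_boundD:
  assumes "supply_shift_bound s W" "is_state x y" "0 \<le> h" "h \<le> y $ j" "s j' \<le> s j"
  shows "W x y \<le> W x (y - h *\<^sub>R axis j 1 + h *\<^sub>R axis j' 1) + h * (s j - s j')"
proof -
  have "is_state x (y - h *\<^sub>R axis j 1)"
    using assms(2,4) by (auto simp: is_state_def axis_def)
  then have "W x (y - h *\<^sub>R axis j 1 + h *\<^sub>R axis j 1)
      \<le> W x (y - h *\<^sub>R axis j 1 + h *\<^sub>R axis j' 1) + h * (s j - s j')"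
    using assms unfolding supply_shift_bound_def by blast
  then show ?thesis by simp
qed

lemma tie_optimal_feasible: "tie_optimal \<rho> G w x y Q \<Longrightarrow> feasible x y Q"
  by (simp add: tie_optimal_def)

lemma tie_optimal_no_gain:
  "tie_optimal \<rho> G w x y Q \<Longrightarrow> feasible x y Q' \<Longrightarrow>
    total_value \<rho> G x y Q \<le> total_value \<rho> G x y Q' \<Longrightarrow> linear_reward w Q' \<le> linear_reward w Q"
  by (simp add: tie_optimal_def)

text \<open>
  Such a match earns nothing, and cancelling it leaves more for the next period.
\<close>

lemma unreachable_unmatched:
  assumes Q: "line_optimal c d s G x y Q" and G: "monotone_lipschitz K G" and ij: "d i < s j"
  shows "Q $ i $ j = 0"
proof (rule ccontr)
  assume "Q $ i $ j \<noteq> 0"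
  have feas: "feasible x y Q" by (rule tie_optimal_feasible[OF Q])
  define h where "h = Q $ i $ j"
  have h: "0 < h" using feas \<open>Q $ i $ j \<noteq> 0\<close> by (auto simp: feasible_def h_def less_le)
  let ?Q = "Q - h *\<^sub>R cell i j"
  have feas': "feasible x y ?Q" using feas h by (auto simp: feasible_iff is_state_def axis_def cell_nth h_def)
  have "G (unmatched_demand x Q) (unmatched_supply y Q) \<le> G (unmatched_demand x ?Q) (unmatched_supply y ?Q)"
    using feas feas' h by (intro state_monotone[OF G]) (auto simp: feasible_iff axis_def)
  then have "total_value (line_reward c d s) G x y Q \<le> total_value (line_reward c d s) G x y ?Q"
    using ij by (simp add: total_value_def line_reward_def)
  from tie_optimal_no_gain[OF Q feas' this] show False
    using ij h by (simp add: nested_weight_def)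
qed

text \<open>
  Otherwise part of the match with \<open>j'\<close> could be moved to \<open>j\<close>. This gains \<open>s j - s j'\<close> per unit
  now, which pays for having supply \<open>j'\<close> instead of \<open>j\<close> in the next period, and it increases the
  weight.
\<close>

lemma near_supply_used_up:
  assumes Q: "line_optimal c d s G x y Q" and G: "supply_shift_bound s G"
    and near: "s j' < s j" "s j \<le> d i" and pos: "0 < Q $ i $ j'"
  shows "unmatched_supply y Q $ j = 0"
proof (rule ccontr)
  assume neq: "unmatched_supply y Q $ j \<noteq> 0"
  have feas: "feasible x y Q" by (rule tie_optimal_feasible[OF Q])
  define h where "h = min (Q $ i $ j') (unmatched_supply y Q $ j)"
  have h: "0 < h" "h \<le> Q $ i $ j'" "h \<le> unmatched_supply y Q $ j"
    using feas neq pos by (auto simp: feasible_def h_def less_le)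
  let ?Q = "Q - h *\<^sub>R cell i j' + h *\<^sub>R cell i j"
  have feas': "feasible x y ?Q" using feas h by (auto simp: feasible_iff is_state_def axis_def cell_nth add_nonneg_nonneg)
  have "G (unmatched_demand x Q) (unmatched_supply y Q)
      \<le> G (unmatched_demand x ?Q) (unmatched_supply y ?Q) + h * (s j - s j')"
    using supply_shift_boundD[OF G, of "unmatched_demand x Q" "unmatched_supply y Q" h j j'] feas h near
    by (simp add: feasible_iff algebra_simps)
  then have "total_value (line_reward c d s) G x y Q \<le> total_value (line_reward c d s) G x y ?Q"
    using near by (simp add: total_value_def line_reward_def algebra_simps)
  from tie_optimal_no_gain[OF Q feas' this] show False
    using near h by (simp add: nested_weight_def)
qed

lemma near_demand_used_up:
  assumes Q: "line_optimal c d s G x y Q" and G: "supply_shift_bound (reversed d) (\<lambda>v u. G u v)"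
    and near: "d i < d i'" "s j \<le> d i" and pos: "0 < Q $ i' $ j"
  shows "unmatched_demand x Q $ i = 0"
proof -
  have "0 < transpose Q $ j $ i'" using pos by (simp add: transpose_def)
  then show ?thesis
    using near_supply_used_up[OF iffD2[OF line_optimal_reversed Q] G, of i' i j] near
    by (simp add: unmatched_transpose)
qed

text \<open>
  Otherwise the crossing pairs could be replaced by the nested ones. All four pairs are reachable,
  so this changes neither the reward nor what is left over, but it increases the weight.
\<close>

lemma matches_do_not_cross:
  assumes Q: "line_optimal c d s G x y Q"
    and order: "s j' < s j" "s j \<le> d i" "d i < d i'"
  shows "Q $ i $ j' = 0 \<or> Q $ i' $ j = 0"
proof (rule ccontr)
  assume neq: "\<not> (Q $ i $ j' = 0 \<or> Q $ i' $ j = 0)"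
  have feas: "feasible x y Q" by (rule tie_optimal_feasible[OF Q])
  define h where "h = min (Q $ i $ j') (Q $ i' $ j)"
  have h: "0 < h" "h \<le> Q $ i $ j'" "h \<le> Q $ i' $ j"
    using feas neq by (auto simp: feasible_def h_def less_le)
  let ?Q = "Q - h *\<^sub>R cell i j' - h *\<^sub>R cell i' j + h *\<^sub>R cell i j + h *\<^sub>R cell i' j'"
  have u: "unmatched_demand x ?Q = unmatched_demand x Q"
    and v: "unmatched_supply y ?Q = unmatched_supply y Q" by simp_all
  have feas': "feasible x y ?Q"
    using feas h order unfolding feasible_iff u v by (auto simp: cell_nth add_nonneg_nonneg)
  have "total_value (line_reward c d s) G x y ?Q = total_value (line_reward c d s) G x y Q"
    using order unfolding total_value_def u v
    by (simp add: line_reward_def) (simp add: algebra_simps)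
  from tie_optimal_no_gain[OF Q feas' eq_refl[OF this[symmetric]]]
  have "h * (exp (s j - d i) + exp (s j' - d i') - exp (s j' - d i) - exp (s j - d i')) \<le> 0"
    using order by (simp add: nested_weight_def) (simp add: algebra_simps)
  moreover have "exp (s j - d i) + exp (s j' - d i') - exp (s j' - d i) - exp (s j - d i')
      = (exp (s j) - exp (s j')) * (exp (- d i) - exp (- d i'))"
    by (simp add: algebra_simps mult_exp_exp)
  moreover have "0 < (exp (s j) - exp (s j')) * (exp (- d i) - exp (- d i'))"
    using order by (intro mult_pos_pos) auto
  ultimately show False
    using h(1) by (metis mult_pos_pos not_le)
qed

section \<open>The value of supply as a function of its location\<close>

text \<open>
  An inequality between the end points of an interval follows from one between each point and
  some point to its left, however near: the infimum of the points that are good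
  enough compared with \<open>e\<close> is itself good enough by continuity, and unless it is 0 another step
  leads further down. This is why only arbitrarily small changes of a decision have to be
  analysed, each involving a few cells that are known to be positive.
\<close>

lemma le_along_path:
  fixes f :: "real \<Rightarrow> real"
  assumes f: "continuous_on {0..e} f" and e: "0 \<le> e"
    and step: "\<And>\<delta>. 0 < \<delta> \<Longrightarrow> \<delta> \<le> e \<Longrightarrow> \<exists>h>0. h \<le> \<delta> \<and> f \<delta> \<le> f (\<delta> - h) + c * h"
  shows "f e \<le> f 0 + c * e"
proof -
  let ?A = "{0..e} \<inter> (\<lambda>\<delta>. f \<delta> + c * (e - \<delta>)) -` {f e..}"
  have "closed ?A"
    by (intro continuous_closed_preimage continuous_intros f)
  then have "compact ?A"
    using compact_Int_closed[of "{0..e}" ?A] by (simp add: Int_assoc[symmetric])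
  moreover have "e \<in> ?A" using e by simp
  ultimately obtain \<delta> where \<delta>: "\<delta> \<in> ?A" "\<And>\<delta>'. \<delta>' \<in> ?A \<Longrightarrow> \<delta> \<le> \<delta>'"
    using compact_attains_inf[of ?A] by blast
  have "\<delta> = 0"
  proof (rule ccontr)
    assume "\<delta> \<noteq> 0"
    then obtain h where h: "0 < h" "h \<le> \<delta>" "f \<delta> \<le> f (\<delta> - h) + c * h"
      using step[of \<delta>] \<delta>(1) by auto
    then have "\<delta> - h \<in> ?A" using \<delta>(1) by (auto simp: algebra_simps)
    then show False using \<delta>(2)[of "\<delta> - h"] h(1) by simp
  qed
  then show ?thesis using \<delta>(1) by simp
qed

text \<open>
  The path replaces supply at \<open>j\<close> by supply at \<open>j'\<close> gradually. Where some supply \<open>j\<close> is left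
  unmatched, the difference is passed on to the next period. Where some is matched with a demand
  type \<open>i\<close>, a bit of that match is rerouted to \<open>j'\<close>; by the choice of the maximiser \<open>j\<close> reaches
  \<open>i\<close>, so \<open>j'\<close> reaches \<open>i\<close> as well and only the distance \<open>s j - s j'\<close> is lost.
\<close>

lemma bellman_supply_shift:
  fixes d :: "'d::finite \<Rightarrow> real" and s :: "'s::finite \<Rightarrow> real"
  assumes G: "monotone_lipschitz K G" and shift: "supply_shift_bound s G"
  shows "supply_shift_bound s (bellman (line_reward c d s) G)"
  unfolding supply_shift_bound_def
proof (intro allI impI)
  fix x :: "real^'d" and y :: "real^'s" and j j' and e :: real
  assume xy: "is_state x y" and e: "0 \<le> e" and near: "s j' \<le> s j"
  let ?V = "bellman (line_reward c d s) G"
  let ?Y = "\<lambda>\<delta>. y + (e - \<delta>) *\<^sub>R axis j' 1 + \<delta> *\<^sub>R axis j 1"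
  obtain K' where K': "monotone_lipschitz K' ?V" by (rule bellman_ex_monotone_lipschitz[OF G])
  have "?V x (?Y e) \<le> ?V x (?Y 0) + (s j - s j') * e"
  proof (rule le_along_path[OF _ e])
    show "continuous_on {0..e} (\<lambda>\<delta>. ?V x (?Y \<delta>))"
      using xy by (intro continuous_on_state_path[OF K'] continuous_intros)
        (auto simp: is_state_def axis_def)
    fix \<delta> :: real assume \<delta>: "0 < \<delta>" "\<delta> \<le> e"
    have st: "is_state x (?Y \<delta>)" using xy \<delta> by (auto simp: is_state_def axis_def)
    obtain Q where Q: "line_optimal c d s G x (?Y \<delta>) Q" using ex_tie_optimal[OF G st] by blast
    have feas: "feasible x (?Y \<delta>) Q" by (rule tie_optimal_feasible[OF Q])
    have "0 < ?Y \<delta> $ j" using xy \<delta> by (auto simp: is_state_def axis_def add_nonneg_pos)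
    with feas show "\<exists>h>0. h \<le> \<delta> \<and> ?V x (?Y \<delta>) \<le> ?V x (?Y (\<delta> - h)) + (s j - s j') * h"
    proof (cases rule: supply_used)
      case 1
      define h where "h = min \<delta> (unmatched_supply (?Y \<delta>) Q $ j)"
      have h: "0 < h" "h \<le> \<delta>" "h \<le> unmatched_supply (?Y \<delta>) Q $ j" using 1 \<delta> by (auto simp: h_def)
      have v: "unmatched_supply (?Y (\<delta> - h)) Q
          = unmatched_supply (?Y \<delta>) Q - h *\<^sub>R axis j 1 + h *\<^sub>R axis j' 1"
        by (simp add: algebra_simps)
      have feas': "feasible x (?Y (\<delta> - h)) Q"
        using feas h by (auto simp only: feasible_iff v intro!: is_state_add_supply is_state_diff_supply)
      have "G (unmatched_demand x Q) (unmatched_supply (?Y \<delta>) Q)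
          \<le> G (unmatched_demand x Q) (unmatched_supply (?Y (\<delta> - h)) Q) + h * (s j - s j')"
        unfolding v using feas h near by (intro supply_shift_boundD[OF shift]) (auto simp: feasible_iff)
      then show ?thesis
        using h by (intro exI[of _ h] conjI bellman_le_move[OF Q G feas'])
          (auto simp: total_value_def mult.commute)
    next
      case (2 i)
      define h where "h = min \<delta> (Q $ i $ j)"
      have h: "0 < h" "h \<le> \<delta>" "h \<le> Q $ i $ j" using 2 \<delta> by (auto simp: h_def)
      have reach: "s j \<le> d i" using unreachable_unmatched[OF Q G, of i j] 2 by force
      let ?Q = "Q - h *\<^sub>R cell i j + h *\<^sub>R cell i j'"
      have u: "unmatched_demand x ?Q = unmatched_demand x Q" by simp
      have v: "unmatched_supply (?Y (\<delta> - h)) ?Q = unmatched_supply (?Y \<delta>) Q"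
        by (simp add: algebra_simps)
      have feas': "feasible x (?Y (\<delta> - h)) ?Q"
        using feas h unfolding feasible_iff u v by (auto simp: cell_nth add_nonneg_nonneg)
      show ?thesis
        using h near reach
        by (intro exI[of _ h] conjI bellman_le_move[OF Q G feas'], unfold total_value_def u v)
          (auto simp: line_reward_def algebra_simps)
    qed
  qed
  then show "?V x (y + e *\<^sub>R axis j 1) \<le> ?V x (y + e *\<^sub>R axis j' 1) + e * (s j - s j')"
    by (simp add: mult.commute)
qed

text \<open>
  The properties of a value function that are inherited by earlier periods whatever
  the rewards \<open>R\<close> are.
\<close>

definition line_value :: "('d::finite \<Rightarrow> real) \<Rightarrow> ('s::finite \<Rightarrow> real) \<Rightarrow> (real^'d \<Rightarrow> real^'s \<Rightarrow> real) \<Rightarrow> bool" where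
  "line_value d s W \<longleftrightarrow> (\<exists>K. monotone_lipschitz K W) \<and> supply_shift_bound s W \<and>
    supply_shift_bound (reversed d) (\<lambda>y x. W x y)"

lemma bellman_line_reversed:
  "bellman (line_reward c (reversed s) (reversed d)) (\<lambda>v u. G u v) y x = bellman (line_reward c d s) G x y"
  unfolding line_reward_reversed by (rule bellman_transpose)

lemma line_value_bellman:
  assumes "line_value d s G" shows "line_value d s (bellman (line_reward c d s) G)"
proof -
  from assms obtain K where K: "monotone_lipschitz K G" by (auto simp: line_value_def)
  have "supply_shift_bound (reversed d) (bellman (line_reward c (reversed s) (reversed d)) (\<lambda>v u. G u v))"
    using bellman_supply_shift[OF monotone_lipschitz_swap[OF K]] assms by (simp add: line_value_def)
  moreover have "bellman (line_reward c (reversed s) (reversed d)) (\<lambda>v u. G u v)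
      = (\<lambda>y x. bellman (line_reward c d s) G x y)"
    by (intro ext bellman_line_reversed)
  ultimately show ?thesis
    using bellman_supply_shift[OF K] assms bellman_ex_monotone_lipschitz[OF K]
    unfolding line_value_def by metis
qed

section \<open>Pairs with no type in between\<close>

text \<open>
  A unit of demand \<open>i\<close>, a unit of supply \<open>j\<close>, and a unit of both are each worth at most \<open>\<rho>\<close>. The
  maximum covers unequal amounts, which arise when the two carry-over fractions differ.
\<close>

definition pair_bound :: "'d \<Rightarrow> 's \<Rightarrow> real \<Rightarrow> (real^'d::finite \<Rightarrow> real^'s::finite \<Rightarrow> real) \<Rightarrow> bool" where
  "pair_bound i j \<rho> W \<longleftrightarrow> (\<forall>x y a b. is_state x y \<longrightarrow> 0 \<le> a \<longrightarrow> 0 \<le> b \<longrightarrow>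
     W (x + a *\<^sub>R axis i 1) (y + b *\<^sub>R axis j 1) \<le> W x y + \<rho> * max a b)"

definition isolated_pair :: "('d \<Rightarrow> real) \<Rightarrow> ('s \<Rightarrow> real) \<Rightarrow> 'd \<Rightarrow> 's \<Rightarrow> bool" where
  "isolated_pair d s i j \<longleftrightarrow> s j \<le> d i \<and> (\<forall>i'. i' \<noteq> i \<longrightarrow> d i' < s j \<or> d i < d i') \<and>
    (\<forall>j'. j' \<noteq> j \<longrightarrow> s j' < s j \<or> d i < s j')"

lemma isolated_pair_reversed: "isolated_pair d s i j \<Longrightarrow> isolated_pair (reversed s) (reversed d) j i"
  by (auto simp: isolated_pair_def)

lemma pair_bound_swap: "pair_bound i j \<rho> W \<Longrightarrow> pair_bound j i \<rho> (\<lambda>y x. W x y)"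
  unfolding pair_bound_def by (metis is_state_swap max.commute)

lemma pair_boundD:
  assumes "pair_bound i j \<rho> W" "is_state x y" "0 \<le> a" "a \<le> x $ i" "0 \<le> b" "b \<le> y $ j"
  shows "W x y \<le> W (x - a *\<^sub>R axis i 1) (y - b *\<^sub>R axis j 1) + \<rho> * max a b"
proof -
  have "is_state (x - a *\<^sub>R axis i 1) (y - b *\<^sub>R axis j 1)"
    using assms by (intro is_state_diff_demand is_state_diff_supply)
  then have "W (x - a *\<^sub>R axis i 1 + a *\<^sub>R axis i 1) (y - b *\<^sub>R axis j 1 + b *\<^sub>R axis j 1)
      \<le> W (x - a *\<^sub>R axis i 1) (y - b *\<^sub>R axis j 1) + \<rho> * max a b"
    using assms unfolding pair_bound_def by blast
  then show ?thesis by simp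
qed

text \<open>
  A unit of \<open>j\<close> alone: if it is matched, then with \<open>i\<close> or with a demand type beyond \<open>i\<close>, so
  cancelling that match costs at most the reward of \<open>(i, j)\<close>, and it frees demand besides.
\<close>

lemma bellman_supply_gain:
  fixes d :: "'d::finite \<Rightarrow> real" and s :: "'s::finite \<Rightarrow> real" and x :: "real^'d" and y :: "real^'s"
  assumes G: "monotone_lipschitz K G" and pair: "pair_bound i j \<rho> G" and iso: "isolated_pair d s i j"
    and \<rho>: "c - (d i - s j) \<le> \<rho>" and xy: "is_state x y" and e: "0 \<le> e"
  shows "bellman (line_reward c d s) G x (y + e *\<^sub>R axis j 1) \<le> bellman (line_reward c d s) G x y + \<rho> * e"
proof -
  let ?V = "bellman (line_reward c d s) G"
  let ?Y = "\<lambda>\<delta>. y + \<delta> *\<^sub>R axis j 1"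
  obtain K' where K': "monotone_lipschitz K' ?V" by (rule bellman_ex_monotone_lipschitz[OF G])
  have "?V x (?Y e) \<le> ?V x (?Y 0) + \<rho> * e"
  proof (rule le_along_path[OF _ e])
    show "continuous_on {0..e} (\<lambda>\<delta>. ?V x (?Y \<delta>))"
      using xy by (intro continuous_on_state_path[OF K'] continuous_intros is_state_add_supply) auto
    fix \<delta> :: real assume \<delta>: "0 < \<delta>" "\<delta> \<le> e"
    have st: "is_state x (?Y \<delta>)" using xy \<delta> by (simp add: is_state_add_supply)
    obtain Q where Q: "line_optimal c d s G x (?Y \<delta>) Q" using ex_tie_optimal[OF G st] by blast
    have feas: "feasible x (?Y \<delta>) Q" by (rule tie_optimal_feasible[OF Q])
    have "0 < ?Y \<delta> $ j" using xy \<delta> by (auto simp: is_state_def axis_def add_nonneg_pos)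
    with feas show "\<exists>h>0. h \<le> \<delta> \<and> ?V x (?Y \<delta>) \<le> ?V x (?Y (\<delta> - h)) + \<rho> * h"
    proof (cases rule: supply_used)
      case 1
      define h where "h = min \<delta> (unmatched_supply (?Y \<delta>) Q $ j)"
      have h: "0 < h" "h \<le> \<delta>" "h \<le> unmatched_supply (?Y \<delta>) Q $ j" using 1 \<delta> by (auto simp: h_def)
      have v: "unmatched_supply (?Y (\<delta> - h)) Q = unmatched_supply (?Y \<delta>) Q - h *\<^sub>R axis j 1"
        by (simp add: algebra_simps)
      have feas': "feasible x (?Y (\<delta> - h)) Q"
        using feas h by (auto simp only: feasible_iff v intro!: is_state_diff_supply)
      have "G (unmatched_demand x Q) (unmatched_supply (?Y \<delta>) Q)
          \<le> G (unmatched_demand x Q) (unmatched_supply (?Y (\<delta> - h)) Q) + \<rho> * h"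
        using pair_boundD[OF pair, of "unmatched_demand x Q" "unmatched_supply (?Y \<delta>) Q" 0 h] feas h
        unfolding v by (simp del: unmatched_state add: feasible_iff is_state_def)
      then show ?thesis
        using h by (intro exI[of _ h] conjI bellman_le_move[OF Q G feas']) (auto simp: total_value_def)
    next
      case (2 k)
      define h where "h = min \<delta> (Q $ k $ j)"
      have h: "0 < h" "h \<le> \<delta>" "h \<le> Q $ k $ j" using 2 \<delta> by (auto simp: h_def)
      have reach: "s j \<le> d k" using unreachable_unmatched[OF Q G, of k j] 2 by force
      have far: "d i \<le> d k" using iso reach by (cases "k = i") (force simp: isolated_pair_def)+
      let ?Q = "Q - h *\<^sub>R cell k j"
      have u: "unmatched_demand x ?Q = unmatched_demand x Q + h *\<^sub>R axis k 1" by simp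
      have v: "unmatched_supply (?Y (\<delta> - h)) ?Q = unmatched_supply (?Y \<delta>) Q"
        by (simp add: algebra_simps)
      have feas': "feasible x (?Y (\<delta> - h)) ?Q"
        using feas h unfolding feasible_iff u v by (auto simp: cell_nth is_state_add_demand)
      have "G (unmatched_demand x Q) (unmatched_supply (?Y \<delta>) Q)
          \<le> G (unmatched_demand x ?Q) (unmatched_supply (?Y (\<delta> - h)) ?Q)"
        unfolding u v
      proof (rule state_monotone[OF G])
        show st': "is_state (unmatched_demand x Q) (unmatched_supply (?Y \<delta>) Q)"
          using feas by (simp only: feasible_iff)
        show "is_state (unmatched_demand x Q + h *\<^sub>R axis k 1) (unmatched_supply (?Y \<delta>) Q)"
          using h by (intro is_state_add_demand[OF st']) simp
      qed (use h in \<open>auto simp: axis_def\<close>)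
      moreover have "h * (c - (d k - s j)) \<le> \<rho> * h"
        unfolding mult.commute[of \<rho>] using \<rho> far h by (intro mult_left_mono) auto
      moreover have "linear_reward (line_reward c d s) ?Q
          = linear_reward (line_reward c d s) Q - h * (c - (d k - s j))"
        using reach by (simp add: line_reward_def)
      ultimately have "total_value (line_reward c d s) G x (?Y \<delta>) Q
          \<le> total_value (line_reward c d s) G x (?Y (\<delta> - h)) ?Q + \<rho> * h"
        unfolding total_value_def by linarith
      then show ?thesis
        using h by (intro exI[of _ h] conjI bellman_le_move[OF Q G feas']) auto
    qed
  qed
  then show ?thesis by simp
qed

text \<open>
  One unit of each, removed gradually. Since nothing lies between \<open>j\<close> and \<open>i\<close>, demand \<open>i\<close> is
  matched with \<open>j\<close> or with some \<open>l\<close> before \<open>j\<close>, or left over; and supply \<open>j\<close> is matched with \<open>i\<close>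
  or with some \<open>k\<close> beyond \<open>i\<close>, or left over. In each combination a single small change of the
  decision accounts for the removed quantities at a cost of at most \<open>\<rho>\<close> per unit.
\<close>

lemma bellman_pair_gain:
  fixes d :: "'d::finite \<Rightarrow> real" and s :: "'s::finite \<Rightarrow> real" and x :: "real^'d" and y :: "real^'s"
  assumes G: "line_value d s G" and pair: "pair_bound i j \<rho> G" and iso: "isolated_pair d s i j"
    and \<rho>: "c - (d i - s j) \<le> \<rho>" and xy: "is_state x y" and e: "0 \<le> e"
  shows "bellman (line_reward c d s) G (x + e *\<^sub>R axis i 1) (y + e *\<^sub>R axis j 1)
    \<le> bellman (line_reward c d s) G x y + \<rho> * e"
proof -
  let ?r = "line_reward c d s"
  let ?V = "bellman ?r G"
  let ?X = "\<lambda>\<delta>. x + \<delta> *\<^sub>R axis i 1" and ?Y = "\<lambda>\<delta>. y + \<delta> *\<^sub>R axis j 1"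
  obtain K where K: "monotone_lipschitz K G" using G by (auto simp: line_value_def)
  obtain K' where K': "monotone_lipschitz K' ?V" by (rule bellman_ex_monotone_lipschitz[OF K])
  have "?V (?X e) (?Y e) \<le> ?V (?X 0) (?Y 0) + \<rho> * e"
  proof (rule le_along_path[OF _ e])
    show "continuous_on {0..e} (\<lambda>\<delta>. ?V (?X \<delta>) (?Y \<delta>))"
      using xy by (intro continuous_on_state_path[OF K'] continuous_intros is_state_add_supply
          is_state_add_demand) auto
    fix \<delta> :: real assume \<delta>: "0 < \<delta>" "\<delta> \<le> e"
    have st: "is_state (?X \<delta>) (?Y \<delta>)" using xy \<delta> by (simp add: is_state_add_supply is_state_add_demand)
    obtain Q where Q: "line_optimal c d s G (?X \<delta>) (?Y \<delta>) Q" using ex_tie_optimal[OF K st] by blast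
    have feas: "feasible (?X \<delta>) (?Y \<delta>) Q" by (rule tie_optimal_feasible[OF Q])
    define u v where "u = unmatched_demand (?X \<delta>) Q" and "v = unmatched_supply (?Y \<delta>) Q"
    have uv: "is_state u v" and q: "0 \<le> Q $ k $ l" for k l
      using feas unfolding feasible_iff u_def v_def by auto
    have reach: "s l \<le> d k" if "0 < Q $ k $ l" for k l
      using unreachable_unmatched[OF Q K, of k l] that by force
    have far: "d i < d k" "s j \<le> d k" if "0 < Q $ k $ j" "k \<noteq> i" for k
      using iso reach[OF that(1)] that(2) by (force simp: isolated_pair_def)+
    have far': "s l < s j" "s l \<le> d i" if "0 < Q $ i $ l" "l \<noteq> j" for l
      using iso reach[OF that(1)] that(2) by (force simp: isolated_pair_def)+
    have ij: "s j \<le> d i" using iso by (simp add: isolated_pair_def)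
    have move: "\<exists>h>0. h \<le> \<delta> \<and> ?V (?X \<delta>) (?Y \<delta>) \<le> ?V (?X (\<delta> - h)) (?Y (\<delta> - h)) + \<rho> * h"
      if h: "0 < h" "h \<le> \<delta>" and Q': "\<And>k l. 0 \<le> Q' $ k $ l"
        and u': "unmatched_demand (?X (\<delta> - h)) Q' = u'" and v': "unmatched_supply (?Y (\<delta> - h)) Q' = v'"
        and st': "is_state u' v'"
        and le: "linear_reward ?r Q + G u v \<le> linear_reward ?r Q' + G u' v' + \<rho> * h" for h Q' u' v'
    proof (intro exI[of _ h] conjI bellman_le_move[OF Q K])
      show "feasible (?X (\<delta> - h)) (?Y (\<delta> - h)) Q'"
        unfolding feasible_iff u' v' using Q' st' by blast
      show "total_value ?r G (?X \<delta>) (?Y \<delta>) Q \<le> total_value ?r G (?X (\<delta> - h)) (?Y (\<delta> - h)) Q' + \<rho> * h"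
        unfolding total_value_def u' v' u_def[symmetric] v_def[symmetric] by (rule le)
    qed (use h in auto)
    have pos: "0 < ?X \<delta> $ i" "0 < ?Y \<delta> $ j"
      using xy \<delta> by (auto simp: is_state_def axis_def add_nonneg_pos)
    have \<rho>': "h * (c - (d i - s j)) \<le> \<rho> * h" if "0 < h" for h
      using \<rho> that by (simp add: mult.commute)
    consider "0 < Q $ i $ j" | "0 < u $ i" "0 < v $ j"
      | k where "0 < u $ i" "0 < Q $ k $ j" "k \<noteq> i"
      | l where "0 < Q $ i $ l" "l \<noteq> j" "0 < v $ j"
      | k l where "0 < Q $ i $ l" "l \<noteq> j" "0 < Q $ k $ j" "k \<noteq> i"
      using demand_used[OF feas pos(1)] supply_used[OF feas pos(2)] unfolding u_def v_def by metis
    then show "\<exists>h>0. h \<le> \<delta> \<and> ?V (?X \<delta>) (?Y \<delta>) \<le> ?V (?X (\<delta> - h)) (?Y (\<delta> - h)) + \<rho> * h"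
    proof cases
      case 1
      define h where "h = min \<delta> (Q $ i $ j)"
      have h: "0 < h" "h \<le> \<delta>" "h \<le> Q $ i $ j" using 1 \<delta> by (auto simp: h_def)
      show ?thesis
      proof (rule move[OF h(1,2) _ _ _ uv])
        show "0 \<le> (Q - h *\<^sub>R cell i j) $ k $ l" for k l using q h by (simp add: cell_nth)
        show "linear_reward ?r Q + G u v \<le> linear_reward ?r (Q - h *\<^sub>R cell i j) + G u v + \<rho> * h"
          using \<rho>'[OF h(1)] ij by (simp add: line_reward_def)
      qed (simp_all add: u_def v_def algebra_simps)
    next
      case 2
      define h where "h = min \<delta> (min (u $ i) (v $ j))"
      have h: "0 < h" "h \<le> \<delta>" "h \<le> u $ i" "h \<le> v $ j" using 2 \<delta> by (auto simp: h_def)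
      show ?thesis
      proof (rule move[OF h(1,2) q])
        show "is_state (u - h *\<^sub>R axis i 1) (v - h *\<^sub>R axis j 1)"
          using uv h by (intro is_state_diff_demand is_state_diff_supply)
        show "linear_reward ?r Q + G u v
            \<le> linear_reward ?r Q + G (u - h *\<^sub>R axis i 1) (v - h *\<^sub>R axis j 1) + \<rho> * h"
          using pair_boundD[OF pair uv, of h h] h by simp
      qed (simp_all add: u_def v_def algebra_simps)
    next
      case (3 k)
      \<comment> \<open>The match \<open>(k, j)\<close> is cancelled. Demand \<open>k\<close> replaces the missing demand \<open>i\<close> in the next
        period, at a loss of \<open>d k - d i\<close>, which is exactly what \<open>(k, j)\<close> earns less than \<open>(i, j)\<close>.\<close>
      define h where "h = min \<delta> (min (u $ i) (Q $ k $ j))"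
      have h: "0 < h" "h \<le> \<delta>" "h \<le> u $ i" "h \<le> Q $ k $ j" using 3 \<delta> by (auto simp: h_def)
      show ?thesis
      proof (rule move[OF h(1,2)])
        show "0 \<le> (Q - h *\<^sub>R cell k j) $ k' $ l" for k' l using q h by (simp add: cell_nth)
        show "is_state (u - h *\<^sub>R axis i 1 + h *\<^sub>R axis k 1) v"
          using uv h by (intro is_state_add_demand is_state_diff_demand) auto
        have "G u v \<le> G (u - h *\<^sub>R axis i 1 + h *\<^sub>R axis k 1) v + h * (- d i - - d k)"
          using supply_shift_boundD[of "reversed d" "\<lambda>y x. G x y" v u h i k] G uv h far(1)[OF 3(2,3)]
          by (simp add: line_value_def is_state_swap[of v u])
        then show "linear_reward ?r Q + G u v
            \<le> linear_reward ?r (Q - h *\<^sub>R cell k j) + G (u - h *\<^sub>R axis i 1 + h *\<^sub>R axis k 1) v + \<rho> * h"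
          using \<rho>'[OF h(1)] far(2)[OF 3(2,3)] by (simp add: line_reward_def algebra_simps)
      qed (simp_all add: u_def v_def algebra_simps)
    next
      case (4 l)
      \<comment> \<open>The mirror image: \<open>(i, l)\<close> is cancelled and supply \<open>l\<close> replaces \<open>j\<close>.\<close>
      define h where "h = min \<delta> (min (v $ j) (Q $ i $ l))"
      have h: "0 < h" "h \<le> \<delta>" "h \<le> v $ j" "h \<le> Q $ i $ l" using 4 \<delta> by (auto simp: h_def)
      show ?thesis
      proof (rule move[OF h(1,2)])
        show "0 \<le> (Q - h *\<^sub>R cell i l) $ k $ l'" for k l' using q h by (simp add: cell_nth)
        show "is_state u (v - h *\<^sub>R axis j 1 + h *\<^sub>R axis l 1)"
          using uv h by (intro is_state_add_supply is_state_diff_supply) auto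
        have "G u v \<le> G u (v - h *\<^sub>R axis j 1 + h *\<^sub>R axis l 1) + h * (s j - s l)"
          using supply_shift_boundD[of s G u v h j l] G uv h far'(1)[OF 4(1,2)]
          by (simp add: line_value_def)
        then show "linear_reward ?r Q + G u v
            \<le> linear_reward ?r (Q - h *\<^sub>R cell i l) + G u (v - h *\<^sub>R axis j 1 + h *\<^sub>R axis l 1) + \<rho> * h"
          using \<rho>'[OF h(1)] far'(2)[OF 4(1,2)] by (simp add: line_reward_def algebra_simps)
      qed (simp_all add: u_def v_def algebra_simps)
    next
      case (5 k l)
      \<comment> \<open>The partners \<open>l\<close> and \<open>k\<close> are matched with each other, so nothing changes for the next
        period.\<close>
      define h where "h = min \<delta> (min (Q $ i $ l) (Q $ k $ j))"
      have h: "0 < h" "h \<le> \<delta>" "h \<le> Q $ i $ l" "h \<le> Q $ k $ j" using 5 \<delta> by (auto simp: h_def)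
      let ?Q = "Q - h *\<^sub>R cell i l - h *\<^sub>R cell k j + h *\<^sub>R cell k l"
      show ?thesis
      proof (rule move[OF h(1,2) _ _ _ uv])
        show "0 \<le> ?Q $ k' $ l'" for k' l' using q h 5 by (auto simp: cell_nth add_nonneg_nonneg)
        have "s l \<le> d k" using far(1)[OF 5(3,4)] far'(2)[OF 5(1,2)] by simp
        then have "linear_reward ?r ?Q = linear_reward ?r Q - h * (c - (d i - s j))"
          using far(2)[OF 5(3,4)] far'(2)[OF 5(1,2)]
          by (simp add: line_reward_def) (simp add: algebra_simps)
        then show "linear_reward ?r Q + G u v \<le> linear_reward ?r ?Q + G u v + \<rho> * h"
          using \<rho>'[OF h(1)] by linarith
        show "unmatched_demand (?X (\<delta> - h)) ?Q = u" "unmatched_supply (?Y (\<delta> - h)) ?Q = v"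
          by (simp_all add: u_def v_def) (simp_all add: algebra_simps)
      qed
    qed
  qed
  then show ?thesis by simp
qed

text \<open>
  The smaller of the two amounts is removed as pairs, the rest as a single type.
\<close>

lemma bellman_pair_bound:
  fixes d :: "'d::finite \<Rightarrow> real" and s :: "'s::finite \<Rightarrow> real"
  assumes G: "line_value d s G" and pair: "pair_bound i j \<rho> G" and iso: "isolated_pair d s i j"
    and \<rho>: "c - (d i - s j) \<le> \<rho>"
  shows "pair_bound i j \<rho> (bellman (line_reward c d s) G)"
  unfolding pair_bound_def
proof (intro allI impI)
  fix x :: "real^'d" and y :: "real^'s" and a b :: real
  assume xy: "is_state x y" and ab: "0 \<le> a" "0 \<le> b"
  let ?V = "bellman (line_reward c d s) G"
  obtain K where K: "monotone_lipschitz K G" using G by (auto simp: line_value_def)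
  have gain: "?V (x + e *\<^sub>R axis i 1) (y + e *\<^sub>R axis j 1) \<le> ?V x y + \<rho> * e"
    if "is_state x y" "0 \<le> e" for x :: "real^'d" and y :: "real^'s" and e
    by (rule bellman_pair_gain[OF G pair iso \<rho> that])
  show "?V (x + a *\<^sub>R axis i 1) (y + b *\<^sub>R axis j 1) \<le> ?V x y + \<rho> * max a b"
  proof (cases "a \<le> b")
    case True
    have "?V (x + a *\<^sub>R axis i 1) (y + (b - a) *\<^sub>R axis j 1 + a *\<^sub>R axis j 1)
        \<le> ?V x (y + (b - a) *\<^sub>R axis j 1) + \<rho> * a"
      using True ab xy by (intro gain is_state_add_supply) auto
    also have "?V x (y + (b - a) *\<^sub>R axis j 1) \<le> ?V x y + \<rho> * (b - a)"
      using True by (intro bellman_supply_gain[OF K pair iso \<rho> xy]) auto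
    finally show ?thesis using True by (simp add: algebra_simps)
  next
    case False
    have "?V (x + (a - b) *\<^sub>R axis i 1 + b *\<^sub>R axis i 1) (y + b *\<^sub>R axis j 1)
        \<le> ?V (x + (a - b) *\<^sub>R axis i 1) y + \<rho> * b"
      using False ab xy by (intro gain is_state_add_demand) auto
    also have "?V (x + (a - b) *\<^sub>R axis i 1) y \<le> ?V x y + \<rho> * (a - b)"
      using bellman_supply_gain[OF monotone_lipschitz_swap[OF K] pair_bound_swap[OF pair]
          isolated_pair_reversed[OF iso], of c y x "a - b"] \<rho> xy False
      by (simp add: bellman_line_reversed is_state_swap[of y x] algebra_simps)
    finally show ?thesis using False by (simp add: algebra_simps max_def)
  qed
qed

text \<open>
  Demand \<open>i\<close> and supply \<open>j\<close> cannot both have another use. If both are left over, they can be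
  matched, since \<open>\<rho>\<close> is as much as they can earn later. If one is left over and the other is matched
  elsewhere, a nearer partner is available. If both are matched elsewhere, the matches cross.
  So one of them is used up entirely by the pair.
\<close>

lemma isolated_pair_matched_greedily:
  assumes Q: "line_optimal c d s G x y Q" and G: "line_value d s G"
    and pair: "pair_bound i j \<rho> G" and iso: "isolated_pair d s i j" and \<rho>: "\<rho> = c - (d i - s j)"
  shows "Q $ i $ j = min (x $ i) (y $ j)"
proof -
  have feas: "feasible x y Q" by (rule tie_optimal_feasible[OF Q])
  let ?u = "unmatched_demand x Q" and ?v = "unmatched_supply y Q"
  have q: "0 \<le> Q $ k $ l" "0 \<le> ?u $ k" "0 \<le> ?v $ l" for k l using feas by (auto simp: feasible_def)
  obtain K where K: "monotone_lipschitz K G" using G by (auto simp: line_value_def)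
  have ij: "s j \<le> d i" using iso by (simp add: isolated_pair_def)
  have reach: "s l \<le> d k" if "0 < Q $ k $ l" for k l
    using unreachable_unmatched[OF Q K, of k l] that by force
  have far: "d i < d k" if "0 < Q $ k $ j" "k \<noteq> i" for k
    using iso reach[OF that(1)] that(2) by (force simp: isolated_pair_def)
  have far': "s l < s j" if "0 < Q $ i $ l" "l \<noteq> j" for l
    using iso reach[OF that(1)] that(2) by (force simp: isolated_pair_def)
  have uv: "?u $ i = 0 \<or> ?v $ j = 0"
  proof (rule ccontr)
    assume neg: "\<not> (?u $ i = 0 \<or> ?v $ j = 0)"
    define h where "h = min (?u $ i) (?v $ j)"
    have h: "0 < h" "h \<le> ?u $ i" "h \<le> ?v $ j" using neg q by (auto simp: h_def less_le)
    let ?Q = "Q + h *\<^sub>R cell i j"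
    have feas': "feasible x y ?Q"
      using feas h by (auto simp: feasible_iff cell_nth is_state_diff_demand is_state_diff_supply)
    have "G ?u ?v \<le> G (unmatched_demand x ?Q) (unmatched_supply y ?Q) + \<rho> * h"
      using pair_boundD[OF pair, of ?u ?v h h] feas h by (simp add: feasible_iff)
    then have "total_value (line_reward c d s) G x y Q \<le> total_value (line_reward c d s) G x y ?Q"
      using ij \<rho> by (simp add: total_value_def line_reward_def mult.commute)
    from tie_optimal_no_gain[OF Q feas' this] show False
      using ij h by (simp add: nested_weight_def mult_le_0_iff)
  qed
  have row: "?v $ j = 0" "\<And>k. k \<noteq> i \<Longrightarrow> Q $ k $ j = 0" if l: "0 < Q $ i $ l" "l \<noteq> j" for l
  proof -
    show "?v $ j = 0"
      using near_supply_used_up[OF Q _ far'[OF l] ij l(1)] G by (simp add: line_value_def)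
    show "Q $ k $ j = 0" if "k \<noteq> i" for k
    proof (rule ccontr)
      assume "Q $ k $ j \<noteq> 0"
      then have "0 < Q $ k $ j" using q(1)[of k j] by linarith
      then show False
        using matches_do_not_cross[OF Q far'[OF l] ij far[OF _ that]] l(1) by auto
    qed
  qed
  have col: "?u $ i = 0" if k: "0 < Q $ k $ j" "k \<noteq> i" for k
    using near_demand_used_up[OF Q _ far[OF k] ij k(1)] G by (simp add: line_value_def)
  have "Q $ i $ j = x $ i \<or> Q $ i $ j = y $ j"
  proof (cases "?u $ i = 0 \<and> (\<forall>l. l \<noteq> j \<longrightarrow> Q $ i $ l = 0)")
    case True
    then have "(\<Sum>l\<in>UNIV. Q $ i $ l) = (\<Sum>l\<in>UNIV. if l = j then Q $ i $ j else 0)"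
      by (intro sum.cong) auto
    then show ?thesis using demand_balance[of x i Q] True by simp
  next
    case False
    have "?v $ j = 0 \<and> (\<forall>k. k \<noteq> i \<longrightarrow> Q $ k $ j = 0)"
    proof (cases "\<exists>l. l \<noteq> j \<and> Q $ i $ l \<noteq> 0")
      case True
      then show ?thesis using row q(1)[of i] by (metis less_le)
    next
      case no: False
      then have "?u $ i \<noteq> 0" using False by auto
      then show ?thesis using uv col q(1)[of _ j] by (metis less_le)
    qed
    moreover from this have "(\<Sum>k\<in>UNIV. Q $ k $ j) = (\<Sum>k\<in>UNIV. if k = i then Q $ i $ j else 0)"
      by (intro sum.cong) auto
    ultimately show ?thesis using supply_balance[of y j Q] by simp
  qed
  moreover have "Q $ i $ j \<le> x $ i"
    using demand_balance[of x i Q] member_le_sum[of j UNIV "\<lambda>l. Q $ i $ l"] q by (smt (verit) UNIV_I finite)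
  moreover have "Q $ i $ j \<le> y $ j"
    using supply_balance[of y j Q] member_le_sum[of i UNIV "\<lambda>k. Q $ k $ j"] q by (smt (verit) UNIV_I finite)
  ultimately show ?thesis by linarith
qed

section \<open>Expectation over the arrivals\<close>

definition expected_next ::
  "'w measure \<Rightarrow> real \<Rightarrow> real \<Rightarrow> ('w \<Rightarrow> real^'d) \<Rightarrow> ('w \<Rightarrow> real^'s) \<Rightarrow>
   (real^'d \<Rightarrow> real^'s \<Rightarrow> real) \<Rightarrow> real^'d::finite \<Rightarrow> real^'s::finite \<Rightarrow> real" where
  "expected_next M \<alpha> \<beta> D S W u v = (\<integral>\<omega>. W (\<alpha> *\<^sub>R u + D \<omega>) (\<beta> *\<^sub>R v + S \<omega>) \<partial>M)"

lemma decision_value_eq: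
  "decision_value M \<alpha> \<beta> \<rho> W D S x y Q = total_value \<rho> (expected_next M \<alpha> \<beta> D S W) x y Q"
  by (simp add: decision_value_def total_value_def expected_next_def linear_reward_def)

text \<open>
  Value functions are controlled on states only. Composing with \<open>clip\<close> extends them continuously to
  all vectors, which makes measurability available.
\<close>

definition clip :: "real^'n \<Rightarrow> real^'n::finite" where
  "clip x = (\<chi> i. max 0 (x $ i))"

lemma continuous_on_clip: "continuous_on UNIV clip"
  unfolding clip_def by (intro continuous_intros)

lemma clip_state: "is_state (clip x) (clip y)"
  by (simp add: clip_def is_state_def)

locale arrivals = prob_space M for M :: "'w measure" +
  fixes \<alpha> \<beta> :: real and D :: "'w \<Rightarrow> real^'d::finite" and S :: "'w \<Rightarrow> real^'s::finite"
  assumes carry: "0 \<le> \<alpha>" "\<alpha> \<le> 1" "0 \<le> \<beta>" "\<beta> \<le> 1"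
    and integrable: "integrable M D" "integrable M S"
    and arrivals_nonneg: "\<omega> \<in> space M \<Longrightarrow> is_state (D \<omega>) (S \<omega>)"
begin

lemma swapped: "arrivals M \<beta> \<alpha> S D"
  by unfold_locales (use carry integrable arrivals_nonneg is_state_swap in auto)

lemma next_state:
  assumes "is_state u v" "\<omega> \<in> space M"
  shows "is_state (\<alpha> *\<^sub>R u + D \<omega>) (\<beta> *\<^sub>R v + S \<omega>)"
  using assms(1) arrivals_nonneg[OF assms(2)] carry by (auto simp: is_state_def)

lemma integrable_next_value:
  assumes W: "monotone_lipschitz K W" and uv: "is_state u v"
  shows "integrable M (\<lambda>\<omega>. W (\<alpha> *\<^sub>R u + D \<omega>) (\<beta> *\<^sub>R v + S \<omega>))"
proof -
  let ?X = "\<lambda>\<omega>. \<alpha> *\<^sub>R u + D \<omega>" and ?Y = "\<lambda>\<omega>. \<beta> *\<^sub>R v + S \<omega>"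
  have XY: "integrable M ?X" "integrable M ?Y" using integrable by auto
  show ?thesis
  proof (rule Bochner_Integration.integrable_bound)
    let ?B = "\<lambda>\<omega>. \<bar>W 0 0\<bar> + K * (CARD('d) * norm (?X \<omega>) + CARD('s) * norm (?Y \<omega>))"
    show "integrable M ?B" using XY by simp
    have cont: "continuous_on UNIV (\<lambda>p. W (clip (fst p)) (clip (snd p)))"
      by (intro continuous_on_state_path[OF W] clip_state continuous_on_compose2[OF continuous_on_clip]
          continuous_intros) auto
    have "(\<lambda>\<omega>. (?X \<omega>, ?Y \<omega>)) \<in> borel_measurable M"
      using XY by (intro borel_measurable_Pair) auto
    from measurable_compose[OF this borel_measurable_continuous_onI[OF cont]]
    have clipped: "(\<lambda>\<omega>. W (clip (?X \<omega>)) (clip (?Y \<omega>))) \<in> borel_measurable M"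
      by simp
    have eq: "W (clip (?X \<omega>)) (clip (?Y \<omega>)) = W (?X \<omega>) (?Y \<omega>)" if "\<omega> \<in> space M" for \<omega>
    proof -
      have "clip (?X \<omega>) = ?X \<omega>" "clip (?Y \<omega>) = ?Y \<omega>"
        using next_state[OF uv that] by (auto simp: clip_def is_state_def vec_eq_iff)
      then show ?thesis by simp
    qed
    show "(\<lambda>\<omega>. W (?X \<omega>) (?Y \<omega>)) \<in> borel_measurable M"
      by (rule iffD1[OF measurable_cong[OF eq] clipped])
    show "AE \<omega> in M. norm (W (?X \<omega>) (?Y \<omega>)) \<le> norm (?B \<omega>)"
    proof (rule AE_I2)
      fix \<omega> assume \<omega>: "\<omega> \<in> space M"
      have K: "0 \<le> K" using W by (simp add: monotone_lipschitz_def)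
      have zero: "is_state (0 :: real^'d) (0 :: real^'s)" by (simp add: is_state_def)
      have "W 0 0 \<le> W (?X \<omega>) (?Y \<omega>)"
        using next_state[OF uv \<omega>]
        by (intro state_monotone[OF W zero]) (auto simp: is_state_def)
      moreover have "W (?X \<omega>) (?Y \<omega>) \<le> W 0 0 + K * (excess (?X \<omega>) 0 + excess (?Y \<omega>) 0)"
        by (rule monotone_lipschitzD[OF W zero next_state[OF uv \<omega>]])
      moreover have "K * (excess (?X \<omega>) 0 + excess (?Y \<omega>) 0)
          \<le> K * (CARD('d) * norm (?X \<omega>) + CARD('s) * norm (?Y \<omega>))"
        using K excess_le_dist[of "?X \<omega>" 0] excess_le_dist[of "?Y \<omega>" 0]
        by (intro mult_left_mono add_mono) simp_all
      ultimately show "norm (W (?X \<omega>) (?Y \<omega>)) \<le> norm (?B \<omega>)" by simp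
    qed
  qed
qed

text \<open>
  Pointwise comparisons of the next values are all that is needed to transfer a property of \<open>W\<close>.
\<close>

lemma expected_next_le:
  assumes W: "monotone_lipschitz K W" and "is_state u v" "is_state u' v'"
    and le: "\<And>\<omega>. \<omega> \<in> space M \<Longrightarrow> W (\<alpha> *\<^sub>R u + D \<omega>) (\<beta> *\<^sub>R v + S \<omega>)
      \<le> W (\<alpha> *\<^sub>R u' + D \<omega>) (\<beta> *\<^sub>R v' + S \<omega>) + c"
  shows "expected_next M \<alpha> \<beta> D S W u v \<le> expected_next M \<alpha> \<beta> D S W u' v' + c"
proof -
  have "expected_next M \<alpha> \<beta> D S W u v
      \<le> (\<integral>\<omega>. W (\<alpha> *\<^sub>R u' + D \<omega>) (\<beta> *\<^sub>R v' + S \<omega>) + c \<partial>M)"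
    unfolding expected_next_def
    using integrable_next_value[OF W] assms(2,3) le by (intro integral_mono) auto
  also have "\<dots> = expected_next M \<alpha> \<beta> D S W u' v' + c"
    unfolding expected_next_def
    using integrable_next_value[OF W assms(3)] by (simp add: prob_space)
  finally show ?thesis .
qed

lemma expected_next_monotone_lipschitz:
  assumes W: "monotone_lipschitz K W"
  shows "monotone_lipschitz K (expected_next M \<alpha> \<beta> D S W)"
  unfolding monotone_lipschitz_def
proof (intro conjI allI impI)
  show K: "0 \<le> K" using W by (simp add: monotone_lipschitz_def)
  fix u u' :: "real^'d" and v v' :: "real^'s"
  assume uv: "is_state u v" and uv': "is_state u' v'"
  have shrink: "excess (\<gamma> *\<^sub>R a' + z) (\<gamma> *\<^sub>R a + z) \<le> excess a' a"
    if "0 \<le> \<gamma>" "\<gamma> \<le> 1" for \<gamma> and a a' z :: "real^'n::finite"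
    unfolding excess_def
  proof (rule sum_mono)
    fix k
    have "\<gamma> * (a' $ k - a $ k) \<le> max 0 (a' $ k - a $ k)"
      using that by (smt (verit) mult_left_le_one_le mult_nonneg_nonpos)
    then show "max 0 ((\<gamma> *\<^sub>R a' + z) $ k - (\<gamma> *\<^sub>R a + z) $ k) \<le> max 0 (a' $ k - a $ k)"
      by (simp add: right_diff_distrib)
  qed
  show "expected_next M \<alpha> \<beta> D S W u' v'
      \<le> expected_next M \<alpha> \<beta> D S W u v + K * (excess u' u + excess v' v)"
  proof (rule expected_next_le[OF W uv' uv])
    fix \<omega> assume \<omega>: "\<omega> \<in> space M"
    have "K * (excess (\<alpha> *\<^sub>R u' + D \<omega>) (\<alpha> *\<^sub>R u + D \<omega>) + excess (\<beta> *\<^sub>R v' + S \<omega>) (\<beta> *\<^sub>R v + S \<omega>))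
        \<le> K * (excess u' u + excess v' v)"
      using carry K by (intro mult_left_mono add_mono shrink)
    then show "W (\<alpha> *\<^sub>R u' + D \<omega>) (\<beta> *\<^sub>R v' + S \<omega>)
        \<le> W (\<alpha> *\<^sub>R u + D \<omega>) (\<beta> *\<^sub>R v + S \<omega>) + K * (excess u' u + excess v' v)"
      using monotone_lipschitzD[OF W next_state[OF uv \<omega>] next_state[OF uv' \<omega>]] by linarith
  qed
qed

lemma expected_next_supply_shift:
  assumes W: "monotone_lipschitz K W" and shift: "supply_shift_bound s W"
  shows "supply_shift_bound s (expected_next M \<alpha> \<beta> D S W)"
  unfolding supply_shift_bound_def
proof (intro allI impI)
  fix u :: "real^'d" and v :: "real^'s" and j j' and h :: real
  assume uv: "is_state u v" and h: "0 \<le> h" and near: "s j' \<le> s j"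
  show "expected_next M \<alpha> \<beta> D S W u (v + h *\<^sub>R axis j 1)
      \<le> expected_next M \<alpha> \<beta> D S W u (v + h *\<^sub>R axis j' 1) + h * (s j - s j')"
  proof (rule expected_next_le[OF W])
    fix \<omega> assume \<omega>: "\<omega> \<in> space M"
    have "W (\<alpha> *\<^sub>R u + D \<omega>) (\<beta> *\<^sub>R v + S \<omega> + (\<beta> * h) *\<^sub>R axis j 1)
        \<le> W (\<alpha> *\<^sub>R u + D \<omega>) (\<beta> *\<^sub>R v + S \<omega> + (\<beta> * h) *\<^sub>R axis j' 1) + \<beta> * h * (s j - s j')"
      using shift next_state[OF uv \<omega>] h near carry unfolding supply_shift_bound_def by simp
    moreover have "\<beta> * h * (s j - s j') \<le> h * (s j - s j')"
      using carry h near by (intro mult_right_mono mult_left_le_one_le) auto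
    ultimately show "W (\<alpha> *\<^sub>R u + D \<omega>) (\<beta> *\<^sub>R (v + h *\<^sub>R axis j 1) + S \<omega>)
        \<le> W (\<alpha> *\<^sub>R u + D \<omega>) (\<beta> *\<^sub>R (v + h *\<^sub>R axis j' 1) + S \<omega>) + h * (s j - s j')"
      by (simp add: algebra_simps)
  qed (use uv h in \<open>simp_all add: is_state_add_supply\<close>)
qed

lemma expected_next_pair_bound:
  assumes W: "monotone_lipschitz K W" and pair: "pair_bound i j \<rho> W" and \<rho>: "0 \<le> \<rho>"
  shows "pair_bound i j \<rho> (expected_next M \<alpha> \<beta> D S W)"
  unfolding pair_bound_def
proof (intro allI impI)
  fix u :: "real^'d" and v :: "real^'s" and a b :: real
  assume uv: "is_state u v" and ab: "0 \<le> a" "0 \<le> b"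
  show "expected_next M \<alpha> \<beta> D S W (u + a *\<^sub>R axis i 1) (v + b *\<^sub>R axis j 1)
      \<le> expected_next M \<alpha> \<beta> D S W u v + \<rho> * max a b"
  proof (rule expected_next_le[OF W])
    fix \<omega> assume \<omega>: "\<omega> \<in> space M"
    have "W (\<alpha> *\<^sub>R u + D \<omega> + (\<alpha> * a) *\<^sub>R axis i 1) (\<beta> *\<^sub>R v + S \<omega> + (\<beta> * b) *\<^sub>R axis j 1)
        \<le> W (\<alpha> *\<^sub>R u + D \<omega>) (\<beta> *\<^sub>R v + S \<omega>) + \<rho> * max (\<alpha> * a) (\<beta> * b)"
      using pair next_state[OF uv \<omega>] ab carry unfolding pair_bound_def by simp
    moreover have "\<rho> * max (\<alpha> * a) (\<beta> * b) \<le> \<rho> * max a b"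
      using carry ab \<rho> by (intro mult_left_mono max.mono mult_left_le_one_le) auto
    ultimately show "W (\<alpha> *\<^sub>R (u + a *\<^sub>R axis i 1) + D \<omega>) (\<beta> *\<^sub>R (v + b *\<^sub>R axis j 1) + S \<omega>)
        \<le> W (\<alpha> *\<^sub>R u + D \<omega>) (\<beta> *\<^sub>R v + S \<omega>) + \<rho> * max a b"
      by (simp add: algebra_simps)
  qed (use uv ab in \<open>simp_all add: is_state_add_supply is_state_add_demand\<close>)
qed

end

lemma (in arrivals) expected_next_line_value:
  assumes "line_value d s W" shows "line_value d s (expected_next M \<alpha> \<beta> D S W)"
proof -
  from assms obtain K where K: "monotone_lipschitz K W" by (auto simp: line_value_def)
  have "supply_shift_bound (reversed d) (expected_next M \<beta> \<alpha> S D (\<lambda>y x. W x y))"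
    using arrivals.expected_next_supply_shift[OF swapped monotone_lipschitz_swap[OF K]] assms
    by (simp add: line_value_def)
  moreover have "expected_next M \<beta> \<alpha> S D (\<lambda>y x. W x y) = (\<lambda>v u. expected_next M \<alpha> \<beta> D S W u v)"
    by (simp add: expected_next_def fun_eq_iff)
  ultimately show ?thesis
    using expected_next_supply_shift[OF K] expected_next_monotone_lipschitz[OF K] assms
    unfolding line_value_def by metis
qed

lemma line_value_zero: "line_value d s (\<lambda>x y. 0)"
  by (auto simp: line_value_def monotone_lipschitz_def supply_shift_bound_def intro!: exI[of _ 0])

lemma pair_bound_zero: "0 \<le> \<rho> \<Longrightarrow> pair_bound i j \<rho> (\<lambda>x y. 0)"
  by (auto simp: pair_bound_def max_def)

section \<open>Coordinates on the segment\<close>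

text \<open>
  The segment is the isometric image of an interval, up to the factor \<open>norm (e - a)\<close>; the distance
  from \<open>a\<close> serves as the coordinate.
\<close>

lemma
  fixes a e p q l :: "'a::euclidean_space"
  assumes "a \<noteq> e" and seg: "p \<in> closed_segment a e" "q \<in> closed_segment a e"
  shows reach_iff_dist: "can_reach e q p \<longleftrightarrow> dist a q \<le> dist a p"
    and dist_along_segment: "dist a q \<le> dist a p \<Longrightarrow> dist q p = dist a p - dist a q"
    and dist_from_end_inj: "dist a p = dist a q \<Longrightarrow> p = q"
    and in_subsegment: "l \<in> closed_segment a e \<Longrightarrow> dist a q \<le> dist a l \<Longrightarrow> dist a l \<le> dist a p \<Longrightarrow>
      l \<in> closed_segment q p"
proof -
  define pt where "pt k = a + k *\<^sub>R (e - a)" for k :: real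
  have pt_seg: "closed_segment (pt b) (pt c) = pt ` closed_segment b c" for b c
  proof -
    have lin: "linear (\<lambda>k. k *\<^sub>R (e - a))" by (simp add: linear_iff scaleR_left_distrib)
    show ?thesis
      unfolding pt_def closed_segment_translation closed_segment_linear_image[OF lin] image_image ..
  qed
  have ends: "pt 0 = a" "pt 1 = e" by (simp_all add: pt_def)
  have dist_pt: "dist (pt b) (pt c) = \<bar>b - c\<bar> * norm (e - a)" for b c
    by (simp add: pt_def dist_norm scaleR_left_diff_distrib[symmetric])
  have n: "0 < norm (e - a)" using assms(1) by simp
  have dist_a: "dist a (pt c) = c * norm (e - a)" if "0 \<le> c" for c
    using dist_pt[of 0 c] ends that by simp
  have coord: "\<exists>k. 0 \<le> k \<and> k \<le> 1 \<and> z = pt k" if "z \<in> closed_segment a e" for z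
    using that pt_seg[of 0 1] unfolding ends by (auto simp: closed_segment_eq_real_ivl)
  have inj: "pt b = pt c \<longleftrightarrow> b = c" for b c using assms(1) by (auto simp: pt_def)
  obtain b where b: "0 \<le> b" "b \<le> 1" "q = pt b" using coord[OF seg(2)] by blast
  obtain c where c: "0 \<le> c" "c \<le> 1" "p = pt c" using coord[OF seg(1)] by blast
  show "can_reach e q p \<longleftrightarrow> dist a q \<le> dist a p"
    unfolding can_reach_def b(3) c(3) dist_a[OF b(1)] dist_a[OF c(1)]
    using pt_seg[of b 1] n b c unfolding ends by (auto simp: closed_segment_eq_real_ivl inj)
  show "dist a q \<le> dist a p \<Longrightarrow> dist q p = dist a p - dist a q"
    unfolding b(3) c(3) dist_a[OF b(1)] dist_a[OF c(1)] dist_pt using n by (simp add: left_diff_distrib)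
  show "dist a p = dist a q \<Longrightarrow> p = q"
    unfolding b(3) c(3) dist_a[OF b(1)] dist_a[OF c(1)] using n by simp
  show "l \<in> closed_segment q p"
    if l: "l \<in> closed_segment a e" and le: "dist a q \<le> dist a l" "dist a l \<le> dist a p"
  proof -
    obtain k where k: "0 \<le> k" "k \<le> 1" "l = pt k" using coord[OF l] by blast
    show ?thesis
      using le unfolding b(3) c(3) k(3) dist_a[OF b(1)] dist_a[OF c(1)] dist_a[OF k(1)] pt_seg
      using n by (auto simp: closed_segment_eq_real_ivl)
  qed
qed

section \<open>Backward recursion and the optimal policy\<close>

lemma value_fun_final: "value_fun M T \<alpha> \<beta> r D S (Suc T) = (\<lambda>x y. 0)"
  by (simp add: value_fun.simps)

lemma value_fun_bellman:
  "t \<le> T \<Longrightarrow> value_fun M T \<alpha> \<beta> r D S t =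
    bellman (r t) (expected_next M \<alpha> \<beta> (D (t + 1)) (S (t + 1)) (value_fun M T \<alpha> \<beta> r D S (t + 1)))"
  by (subst value_fun.simps) (simp add: bellman_def decision_value_eq fun_eq_iff)

lemma expected_next_zero: "expected_next M \<alpha> \<beta> D S (\<lambda>x y. 0) = (\<lambda>u v. 0)"
  by (simp add: expected_next_def fun_eq_iff)

lemma backward_induction:
  assumes "P (Suc T)" "\<And>t. t \<in> {t0..T} \<Longrightarrow> P (Suc t) \<Longrightarrow> P t" "t \<in> {t0..Suc T}"
  shows "P t"
proof -
  have "t \<le> Suc T" using assms(3) by simp
  then show ?thesis
    by (induction rule: inc_induct) (use assms in auto)
qed


theorem proposition6:
  fixes M :: "'w measure" and T :: nat and \<alpha> \<beta> :: real
    and D :: "nat \<Rightarrow> 'w \<Rightarrow> real^'d::finite" and S :: "nat \<Rightarrow> 'w \<Rightarrow> real^'s::finite"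
    and start end_pt :: "'a::euclidean_space"
    and locD :: "'d \<Rightarrow> 'a" and locS :: "'s \<Rightarrow> 'a"
    and R :: "nat \<Rightarrow> real" and r :: "nat \<Rightarrow> 'd \<Rightarrow> 's \<Rightarrow> real"
  assumes "1 \<le> T" and "\<alpha> \<in> {0..1}" and "\<beta> \<in> {0..1}"
    and "prob_space M"
    and "\<And>t. t \<in> {1..T} \<Longrightarrow> integrable M (D t)"
    and "\<And>t. t \<in> {1..T} \<Longrightarrow> integrable M (S t)"
    and "\<And>t \<omega>. t \<in> {1..T} \<Longrightarrow> \<omega> \<in> space M \<Longrightarrow> is_state (D t \<omega>) (S t \<omega>)"
    and "start \<noteq> end_pt"
    and "range locD \<subseteq> closed_segment start end_pt" and "inj locD"
    and "range locS \<subseteq> closed_segment start end_pt" and "inj locS"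
    and "r = unidirectional_reward T R end_pt locD locS"
  shows "\<exists>P. optimal_policy M T \<alpha> \<beta> r D S P \<and>
    \<comment> \<open>(i)\<close>
    (\<forall>i j j'. can_reach end_pt (locS j) (locD i) \<and> can_reach end_pt (locS j') (locD i) \<and>
       dist (locS j) (locD i) < dist (locS j') (locD i) \<longrightarrow>
       matches_before_supply T \<alpha> \<beta> r P i j j') \<and>
    (\<forall>i i' j. can_reach end_pt (locS j) (locD i) \<and> can_reach end_pt (locS j) (locD i') \<and>
       dist (locS j) (locD i) < dist (locS j) (locD i') \<longrightarrow>
       matches_before_demand T \<alpha> \<beta> r P i i' j) \<and>
    \<comment> \<open>(ii)\<close>
    ((\<forall>s\<in>{1..T}. \<forall>t\<in>{1..T}. s \<le> t \<longrightarrow> R t \<le> R s) \<longrightarrow>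
     (\<forall>i j. can_reach end_pt (locS j) (locD i) \<and> no_types_between locD locS i j \<longrightarrow>
       (\<forall>t\<in>{1..T}. \<forall>x y. is_state x y \<and> 0 \<le> r t i j \<longrightarrow>
          P t x y $ i $ j = min (x $ i) (y $ j))))"
proof -
  define d where "d i = dist start (locD i)" for i
  define s where "s j = dist start (locS j)" for j
  have segD: "locD i \<in> closed_segment start end_pt" for i using assms(9) by auto
  have segS: "locS j \<in> closed_segment start end_pt" for j using assms(11) by auto
  have reach: "can_reach end_pt (locS j) (locD i) \<longleftrightarrow> s j \<le> d i" for i j
    unfolding s_def d_def by (rule reach_iff_dist[OF assms(8) segD segS])
  have dist_eq: "dist (locS j) (locD i) = d i - s j" if "s j \<le> d i" for i j
    using that dist_along_segment[OF assms(8) segD segS] unfolding s_def d_def by blast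
  have r: "r t = line_reward (R t) d s" if "t \<in> {1..T}" for t
    using that by (auto simp: fun_eq_iff assms(13) unidirectional_reward_def line_reward_def reach dist_eq)
  have d_inj: "i = i'" if "d i = d i'" for i i'
    using that dist_from_end_inj[OF assms(8) segD segD] injD[OF assms(10)] unfolding d_def by blast
  have s_inj: "j = j'" if "s j = s j'" for j j'
    using that dist_from_end_inj[OF assms(8) segS segS] injD[OF assms(12)] unfolding s_def by blast
  have isolated: "isolated_pair d s i j"
    if "can_reach end_pt (locS j) (locD i)" "no_types_between locD locS i j" for i j
    using that in_subsegment[OF assms(8) segD segS segD, of j _ i]
      in_subsegment[OF assms(8) segD segS segS, of j _ i]
    unfolding isolated_pair_def no_types_between_def reach
    by (auto simp: d_def[symmetric] s_def[symmetric] not_le[symmetric])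
  define V where "V = value_fun M T \<alpha> \<beta> r D S"
  define G where "G t = expected_next M \<alpha> \<beta> (D (t + 1)) (S (t + 1)) (V (t + 1))" for t
  have V_final: "V (Suc T) = (\<lambda>x y. 0)" unfolding V_def by (rule value_fun_final)
  have V: "V t = bellman (line_reward (R t) d s) (G t)" if "t \<in> {1..T}" for t
    unfolding V_def G_def using value_fun_bellman[of t T M \<alpha> \<beta> r D S] that r[OF that] by simp
  have arr: "arrivals M \<alpha> \<beta> (D t) (S t)" if "t \<in> {1..T}" for t
    unfolding arrivals_def arrivals_axioms_def using assms(2-7) that by auto
  have G_final: "G T = (\<lambda>u v. 0)" unfolding G_def by (simp add: V_final expected_next_zero)
  \<comment> \<open>The last period is treated separately because no arrivals follow it; its future value is 0.\<close>
  have G_line: "line_value d s (G t)" if "t \<in> {1..T}" "line_value d s (V (Suc t))" for t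
  proof (cases "t = T")
    case True
    then show ?thesis by (simp add: G_final line_value_zero)
  next
    case False
    then show ?thesis
      using arrivals.expected_next_line_value[OF arr[of "t + 1"]] that unfolding G_def by simp
  qed
  have V_line: "line_value d s (V t)" if "t \<in> {1..Suc T}" for t
  proof (rule backward_induction[OF _ _ that])
    show "line_value d s (V (Suc T))" unfolding V_final by (rule line_value_zero)
    show "line_value d s (V t)" if "t \<in> {1..T}" "line_value d s (V (Suc t))" for t
      unfolding V[OF that(1)] by (intro line_value_bellman G_line that)
  qed
  have G: "line_value d s (G t)" if "t \<in> {1..T}" for t
    using G_line[OF that] V_line[of "Suc t"] that by simp
  have pair: "pair_bound i j (R t - (d i - s j)) (G t)"
    if decreasing: "\<forall>s\<in>{1..T}. \<forall>t\<in>{1..T}. s \<le> t \<longrightarrow> R t \<le> R s"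
      and iso: "isolated_pair d s i j" and t: "t \<in> {1..T}" and pos: "0 \<le> R t - (d i - s j)" for i j t
  proof -
    let ?\<rho> = "R t - (d i - s j)"
    \<comment> \<open>The bound \<open>\<rho>\<close> is that of period \<open>t\<close> and is kept fixed while \<open>k\<close> runs backwards; it dominates
      the reward of the pair in every later period because \<open>R\<close> decreases.\<close>
    have G_pair: "pair_bound i j ?\<rho> (G k)" if k: "k \<in> {t..T}" "pair_bound i j ?\<rho> (V (Suc k))" for k
    proof (cases "k = T")
      case True
      then show ?thesis by (simp add: G_final pair_bound_zero[OF pos])
    next
      case False
      then have k': "k + 1 \<in> {1..T}" using k(1) by simp
      obtain K where "monotone_lipschitz K (V (k + 1))"
        using V_line[of "k + 1"] k' by (auto simp: line_value_def)
      then show ?thesis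
        unfolding G_def using arrivals.expected_next_pair_bound[OF arr[OF k'] _ _ pos] k(2) by simp
    qed
    have "pair_bound i j ?\<rho> (V k)" if "k \<in> {t..Suc T}" for k
    proof (rule backward_induction[OF _ _ that])
      show "pair_bound i j ?\<rho> (V (Suc T))" unfolding V_final by (rule pair_bound_zero[OF pos])
      fix k assume k: "k \<in> {t..T}" "pair_bound i j ?\<rho> (V (Suc k))"
      then have k1: "k \<in> {1..T}" using t by simp
      have "R k \<le> R t" using decreasing t k1 k(1) by simp
      then show "pair_bound i j ?\<rho> (V k)"
        unfolding V[OF k1] by (intro bellman_pair_bound G[OF k1] G_pair[OF k] iso) simp
    qed
    then show ?thesis using G_pair[of t] t by simp
  qed
  define P where "P t x y = (SOME Q. line_optimal (R t) d s (G t) x y Q)" for t x y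
  have P: "line_optimal (R t) d s (G t) x y (P t x y)" if t: "t \<in> {1..T}" and xy: "is_state x y" for t x y
  proof -
    obtain K where "monotone_lipschitz K (G t)" using G[OF t] by (auto simp: line_value_def)
    from ex_tie_optimal[OF this xy] show ?thesis unfolding P_def by (rule someI_ex)
  qed
  have lip: "\<exists>K. monotone_lipschitz K (G t)" and shift: "supply_shift_bound s (G t)"
    and shift': "supply_shift_bound (reversed d) (\<lambda>v u. G t u v)" if "t \<in> {1..T}" for t
    using G[OF that] by (auto simp: line_value_def)
  have used: "s j \<le> d i" if t: "t \<in> {1..T}" and xy: "is_state x y" and "P t x y $ i $ j \<noteq> 0" for t x y i j
    using unreachable_unmatched[OF P[OF t xy]] lip[OF t] that(3) by (metis not_le)
  have nonneg: "0 \<le> P t x y $ i $ j" if "t \<in> {1..T}" "is_state x y" for t x y i j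
    using tie_optimal_feasible[OF P[OF that]] by (simp add: feasible_def)
  have "optimal_policy M T \<alpha> \<beta> r D S P"
    unfolding optimal_policy_def
  proof (intro ballI allI impI conjI)
    fix t and x :: "real^'d" and y :: "real^'s" assume t: "t \<in> {1..T}" and xy: "is_state x y"
    show "feasible x y (P t x y)" by (rule tie_optimal_feasible[OF P[OF t xy]])
    show "decision_value M \<alpha> \<beta> (r t) (value_fun M T \<alpha> \<beta> r D S (t + 1)) (D (t + 1)) (S (t + 1)) x y (P t x y)
        = value_fun M T \<alpha> \<beta> r D S t x y"
      using tie_optimal_bellman[OF P[OF t xy]] V[OF t]
      by (simp add: decision_value_eq r[OF t] V_def G_def)
  qed
  moreover have "matches_before_supply T \<alpha> \<beta> r P i j j'"
    if ij: "s j \<le> d i" and near: "s j' < s j" for i j j'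
    unfolding matches_before_supply_def
  proof (intro ballI allI impI disjCI)
    fix t and x :: "real^'d" and y :: "real^'s" assume t: "t \<in> {1..T}" and xy: "is_state x y"
      and "available_supply T \<alpha> \<beta> r i j y (P t x y) \<noteq> 0"
    let ?Q = "P t x y"
    \<comment> \<open>Demand of lower priority at \<open>j\<close> lies beyond \<open>i\<close>, so a match of it with \<open>j\<close> would cross
      \<open>(i, j')\<close>. Hence the supply of \<open>j\<close> available to \<open>i\<close> is just the unmatched supply.\<close>
    let ?low = "{i''. i'' \<noteq> i \<and> priority_s T \<alpha> \<beta> r (i, j) (i'', j)}"
    show "?Q $ i $ j' = 0"
    proof (rule ccontr)
      assume "?Q $ i $ j' \<noteq> 0"
      then have pos: "0 < ?Q $ i $ j'" using nonneg[OF t xy, of i j'] by simp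
      have "?Q $ k $ j = 0" if "k \<in> ?low" for k
      proof (rule ccontr)
        assume nz: "?Q $ k $ j \<noteq> 0"
        have "s j \<le> d k" by (rule used[OF t xy nz])
        moreover have "r t k j \<le> r t i j" "k \<noteq> i"
          using that t by (auto simp: priority_s_def priority_def)
        ultimately have "d i < d k" using ij d_inj[of i k] by (auto simp: r[OF t] line_reward_def less_le)
        from matches_do_not_cross[OF P[OF t xy] near ij this] nz pos show False by simp
      qed
      then have "(\<Sum>k\<in>UNIV - ?low. ?Q $ k $ j) = (\<Sum>k\<in>UNIV. ?Q $ k $ j)"
        by (intro sum.mono_neutral_left) auto
      moreover have "unmatched_supply y ?Q $ j = 0"
        by (rule near_supply_used_up[OF P[OF t xy] shift[OF t] near ij pos])
      ultimately have "available_supply T \<alpha> \<beta> r i j y ?Q = 0"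
        using supply_balance[of y j ?Q] by (simp add: available_supply_def)
      then show False using \<open>available_supply T \<alpha> \<beta> r i j y ?Q \<noteq> 0\<close> by simp
    qed
  qed
  moreover have "matches_before_demand T \<alpha> \<beta> r P i i' j"
    if ij: "s j \<le> d i" and near: "d i < d i'" for i i' j
    unfolding matches_before_demand_def
  proof (intro ballI allI impI disjCI)
    fix t and x :: "real^'d" and y :: "real^'s" assume t: "t \<in> {1..T}" and xy: "is_state x y"
      and "available_demand T \<alpha> \<beta> r i j x (P t x y) \<noteq> 0"
    let ?Q = "P t x y"
    \<comment> \<open>Supply of lower priority at \<open>i\<close> lies before \<open>j\<close>, so a match of it with \<open>i\<close> would cross
      \<open>(i', j)\<close>.\<close>
    let ?low = "{j''. j'' \<noteq> j \<and> priority_s T \<alpha> \<beta> r (i, j) (i, j'')}"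
    show "?Q $ i' $ j = 0"
    proof (rule ccontr)
      assume "?Q $ i' $ j \<noteq> 0"
      then have pos: "0 < ?Q $ i' $ j" using nonneg[OF t xy, of i' j] by simp
      have "?Q $ i $ l = 0" if "l \<in> ?low" for l
      proof (rule ccontr)
        assume nz: "?Q $ i $ l \<noteq> 0"
        have "s l \<le> d i" by (rule used[OF t xy nz])
        moreover have "r t i l \<le> r t i j" "l \<noteq> j"
          using that t by (auto simp: priority_s_def priority_def)
        ultimately have "s l < s j" using ij s_inj[of l j] by (auto simp: r[OF t] line_reward_def less_le)
        from matches_do_not_cross[OF P[OF t xy] this ij near] nz pos show False by simp
      qed
      then have "(\<Sum>l\<in>UNIV - ?low. ?Q $ i $ l) = (\<Sum>l\<in>UNIV. ?Q $ i $ l)"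
        by (intro sum.mono_neutral_left) auto
      moreover have "unmatched_demand x ?Q $ i = 0"
        by (rule near_demand_used_up[OF P[OF t xy] shift'[OF t] near ij pos])
      ultimately have "available_demand T \<alpha> \<beta> r i j x ?Q = 0"
        using demand_balance[of x i ?Q] by (simp add: available_demand_def)
      then show False using \<open>available_demand T \<alpha> \<beta> r i j x ?Q \<noteq> 0\<close> by simp
    qed
  qed
  moreover have "P t x y $ i $ j = min (x $ i) (y $ j)"
    if "\<forall>s\<in>{1..T}. \<forall>t\<in>{1..T}. s \<le> t \<longrightarrow> R t \<le> R s" and iso: "isolated_pair d s i j"
      and t: "t \<in> {1..T}" and xy: "is_state x y" and "0 \<le> r t i j" for i j t x y
  proof -
    have "0 \<le> R t - (d i - s j)"
      using that(5) iso by (simp add: r[OF t] line_reward_def isolated_pair_def)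
    from isolated_pair_matched_greedily[OF P[OF t xy] G[OF t] pair[OF that(1) iso t this] iso refl]
    show ?thesis .
  qed
  ultimately show ?thesis
    using isolated by (intro exI[of _ P]) (auto simp: reach dist_eq)
qed

end
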